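(* Let $n\geq 2$ and let $\Phi:\mathcal{K}^n\to\mathcal{K}^n$ be Minkowski additive, continuous and translation invariant. Then $\Phi$ is monotonic and satisfies (VC) if and only if there exists $g\in\mathrm{GL}(n)$ such that $$\Phi(K)=g(DK)\quad\text{for all }K\in\mathcal{K}^n.$$
   Context: $\mathcal{K}^n$ is the set of (nonempty) compact convex subsets of $\mathbb{R}^n$, with Minkowski addition and the Hausdorff metric. $V_n$ is $n$-dimensional Lebesgue measure. $\Phi$ is Minkowski additive if $\Phi(K+L)=\Phi(K)+\Phi(L)$ for all $K,L\in\mathcal{K}^n$; translation invariant if $\Phi(K+t)=\Phi(K)$ for all $K\in\mathcal{K}^n$, $t\in\mathbb{R}^n$; continuous means with respect to the Hausdorff metric on both sides; monotonic means that $K\subseteq L$ implies $\Phi(K)\subseteq\Phi(L)$. $\Phi$ satisfies (VC) if there are constants $c_\Phi,C_\Phi>0$ such that $c_\Phi V_n(K)\leq V_n(\Phi(K))\leq C_\Phi V_n(K)$ for all $K\in\mathcal{K}^n$. $DK=K+(-K)$ is the difference body, with $-K=\{-x: x\in K\}$. *)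

theory Defs
  imports "HOL-Analysis.Analysis"
begin

definition convex_bodies :: "'a::euclidean_space set set" where
  "convex_bodies = {K. K \<noteq> {} \<and> compact K \<and> convex K}"

text \<open>Only the second branch matters for convex bodies. The junk value 0 keeps the function
  nonnegative everywhere, as the locale \<^locale>\<open>Metric_space\<close> requires also outside its carrier.\<close>
definition hausdorff_dist :: "'a::metric_space set \<Rightarrow> 'a set \<Rightarrow> real" where
  "hausdorff_dist K L =
     (if K = {} \<or> L = {} \<or> \<not> bounded K \<or> \<not> bounded L then 0
      else max (SUP x\<in>K. infdist x L) (SUP y\<in>L. infdist y K))"

lemma hausdorff_dist_commute: "hausdorff_dist K L = hausdorff_dist L K"
  by (auto simp: hausdorff_dist_def max.commute)

lemma bdd_above_infdist:
  assumes "bounded K"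
  shows "bdd_above ((\<lambda>x. infdist x L) ` K)"
proof -
  obtain a e where e: "\<And>x. x \<in> K \<Longrightarrow> dist a x \<le> e"
    using assms by (auto simp: bounded_def)
  have "infdist x L \<le> infdist a L + e" if "x \<in> K" for x
    using infdist_triangle[of x L a] e[OF that] by (simp add: dist_commute)
  thus ?thesis by (intro bdd_aboveI2)
qed

lemma infdist_le_hausdorff_dist:
  assumes "bounded K" "bounded L" "L \<noteq> {}" "x \<in> K"
  shows "infdist x L \<le> hausdorff_dist K L"
  using assms cSUP_upper[OF assms(4) bdd_above_infdist[OF assms(1)], of L]
  by (auto simp: hausdorff_dist_def le_max_iff_disj)

lemma hausdorff_dist_le:
  assumes "K \<noteq> {}" "L \<noteq> {}" "0 \<le> e"
    and "\<And>x. x \<in> K \<Longrightarrow> infdist x L \<le> e" "\<And>y. y \<in> L \<Longrightarrow> infdist y K \<le> e"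
  shows "hausdorff_dist K L \<le> e"
  unfolding hausdorff_dist_def using assms by (auto intro!: cSUP_least)

lemma hausdorff_dist_nonneg: "0 \<le> hausdorff_dist K L"
proof (cases "K = {} \<or> L = {} \<or> \<not> bounded K \<or> \<not> bounded L")
  case False
  then obtain x where "x \<in> K" by auto
  with False have "infdist x L \<le> hausdorff_dist K L"
    by (intro infdist_le_hausdorff_dist) auto
  thus ?thesis using infdist_nonneg[of x L] by linarith
qed (simp add: hausdorff_dist_def)

lemma infdist_triangle_hausdorff:
  fixes K L M :: "'a::euclidean_space set"
  assumes "K \<in> convex_bodies" "L \<in> convex_bodies" "M \<in> convex_bodies" "x \<in> K"
  shows "infdist x M \<le> hausdorff_dist K L + hausdorff_dist L M"
proof -
  have L: "compact L" "L \<noteq> {}" "bounded K" "bounded L" "bounded M" "M \<noteq> {}"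
    using assms by (auto simp: convex_bodies_def compact_imp_bounded)
  obtain y where y: "y \<in> L" "infdist x L = dist x y"
    using infdist_attains_inf[of L x] L compact_imp_closed by blast
  have "infdist x M \<le> infdist y M + dist x y" by (rule infdist_triangle)
  moreover have "infdist y M \<le> hausdorff_dist L M"
    using infdist_le_hausdorff_dist L y by blast
  moreover have "dist x y \<le> hausdorff_dist K L"
    using infdist_le_hausdorff_dist[of K L x] L y assms by simp
  ultimately show ?thesis by linarith
qed

lemma Metric_space_hausdorff_dist:
  "Metric_space (convex_bodies :: 'a::euclidean_space set set) hausdorff_dist"
proof
  fix K L :: "'a set"
  show "0 \<le> hausdorff_dist K L" by (rule hausdorff_dist_nonneg)
  show "hausdorff_dist K L = hausdorff_dist L K" by (rule hausdorff_dist_commute)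
next
  fix K L :: "'a set"
  assume *: "K \<in> convex_bodies" "L \<in> convex_bodies"
  hence KL: "compact K" "K \<noteq> {}" "compact L" "L \<noteq> {}" by (auto simp: convex_bodies_def)
  show "hausdorff_dist K L = 0 \<longleftrightarrow> K = L"
  proof
    have sub: "A \<subseteq> B"
      if "hausdorff_dist A B = 0" "compact A" "compact B" "B \<noteq> {}" for A B :: "'a set"
    proof
      fix x assume "x \<in> A"
      hence "infdist x B = 0"
        using infdist_le_hausdorff_dist[of A B x] that infdist_nonneg[of x B]
        by (simp add: compact_imp_bounded)
      thus "x \<in> B" using that by (simp add: in_closed_iff_infdist_zero compact_imp_closed)
    qed
    assume "hausdorff_dist K L = 0"
    thus "K = L" using sub[of K L] sub[of L K] KL by (simp add: hausdorff_dist_commute)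
  next
    assume "K = L"
    thus "hausdorff_dist K L = 0" using KL by (simp add: hausdorff_dist_def)
  qed
next
  fix K L M :: "'a set"
  assume *: "K \<in> convex_bodies" "L \<in> convex_bodies" "M \<in> convex_bodies"
  show "hausdorff_dist K M \<le> hausdorff_dist K L + hausdorff_dist L M"
  proof (rule hausdorff_dist_le)
    show "infdist x M \<le> hausdorff_dist K L + hausdorff_dist L M" if "x \<in> K" for x
      using infdist_triangle_hausdorff[OF * that] .
    show "infdist y K \<le> hausdorff_dist K L + hausdorff_dist L M" if "y \<in> M" for y
      using infdist_triangle_hausdorff[of M L K y] * that by (simp add: hausdorff_dist_commute)
  qed (use * in \<open>auto simp: convex_bodies_def hausdorff_dist_nonneg\<close>)
qed

definition hausdorff_topology :: "'a::euclidean_space set topology" where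
  "hausdorff_topology = Metric_space.mtopology convex_bodies hausdorff_dist"

lemma topspace_hausdorff_topology: "topspace hausdorff_topology = convex_bodies"
  unfolding hausdorff_topology_def
  by (rule Metric_space.topspace_mtopology[OF Metric_space_hausdorff_dist])

text \<open>An operator on convex bodies is a function on arbitrary sets of which only the values on
  \<^const>\<open>convex_bodies\<close> are used. Sums of sets are Minkowski sums (\<open>set_plus_def\<close>).\<close>

definition minkowski_additive :: "('a::euclidean_space set \<Rightarrow> 'a set) \<Rightarrow> bool" where
  "minkowski_additive \<Phi> \<longleftrightarrow>
     (\<forall>K\<in>convex_bodies. \<forall>L\<in>convex_bodies. \<Phi> (K + L) = \<Phi> K + \<Phi> L)"

definition translation_invariant :: "('a::euclidean_space set \<Rightarrow> 'a set) \<Rightarrow> bool" where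
  "translation_invariant \<Phi> \<longleftrightarrow>
     (\<forall>K\<in>convex_bodies. \<forall>t. \<Phi> ((\<lambda>x. x + t) ` K) = \<Phi> K)"

definition volume_constraint :: "('a::euclidean_space set \<Rightarrow> 'a set) \<Rightarrow> bool" where
  "volume_constraint \<Phi> \<longleftrightarrow>
     (\<exists>c C. 0 < c \<and> 0 < C \<and>
        (\<forall>K\<in>convex_bodies. c * measure lebesgue K \<le> measure lebesgue (\<Phi> K) \<and>
                           measure lebesgue (\<Phi> K) \<le> C * measure lebesgue K))"

definition difference_body :: "'a::euclidean_space set \<Rightarrow> 'a set" where
  "difference_body K = K + uminus ` K"

end

theory Submission
  imports Defs
begin

text \<open>
  For the hard direction let \<open>S v\<close> be the segment from 0 to \<open>v\<close>. By (VC) a zonotope is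
  full-dimensional iff its image is; counting dimensions, every \<open>\<Phi> (S v)\<close> is a segment,
  and linearly independent vectors give linearly independent segments. Each of \<open>S v\<close>,
  \<open>S w\<close>, \<open>S (v + w)\<close> is contained in a translate of the sum of the other two; applying \<open>\<Phi>\<close>
  forces the images to be centred, \<open>\<Phi> (S v) = [-f v, f v]\<close>, with
  \<open>f (v + w) = \<plusminus>f v \<plusminus> f w\<close>. Such an \<open>f\<close> agrees up to signs with an invertible linear map \<open>g\<close>.
  A body \<open>K\<close> contains the segments between its points, whence \<open>g (DK) \<subseteq> \<Phi> K\<close>. It is contained in
  prisms which in one direction \<open>u\<close> are as thin as \<open>K\<close>; these are translates of sums of segments, so
  \<open>\<Phi> K \<subseteq> g (DK)\<close>.

  In the other direction the point is \<open>V(DK) \<le> (4n)\<^sup>n V(K)\<close>. Take a parallelepiped of maximal volume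
  spanned by \<open>n\<close> points of \<open>K\<close>, where \<open>0 \<in> K\<close>; by Cramer's rule all points of \<open>K\<close> have coordinates in
  \<open>[-1, 1]\<close> with respect to it, so \<open>DK\<close> lies in a translate of \<open>4n K\<close>.
\<close>

section \<open>Convex bodies\<close>

lemma convex_bodies_plus:
  fixes K L :: "'a::euclidean_space set"
  assumes "K \<in> convex_bodies" "L \<in> convex_bodies"
  shows "K + L \<in> convex_bodies"
proof -
  have "K + L = {x + y |x y. x \<in> K \<and> y \<in> L}"
    by (auto simp: set_plus_def)
  then have "compact (K + L)"
    using assms compact_sums[of K L] by (simp add: convex_bodies_def)
  then show ?thesis
    using assms by (auto simp: convex_bodies_def convex_set_plus intro: set_plus_intro)
qed

lemma convex_bodies_sum:
  fixes A :: "'b \<Rightarrow> 'a::euclidean_space set"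
  assumes "\<And>i. i \<in> I \<Longrightarrow> A i \<in> convex_bodies"
  shows "(\<Sum>i\<in>I. A i) \<in> convex_bodies"
  using assms
  by (induction I rule: infinite_finite_induct)
     (auto simp: convex_bodies_plus, auto simp: convex_bodies_def)

lemma convex_bodies_segment: "closed_segment a b \<in> convex_bodies"
  by (simp add: convex_bodies_def)

lemma convex_bodies_translate:
  fixes K :: "'a::euclidean_space set"
  assumes "K \<in> convex_bodies"
  shows "(\<lambda>x. x + t) ` K \<in> convex_bodies"
proof -
  have "(\<lambda>x. x + t) ` K = (+) t ` K" by (simp add: add.commute)
  with assms show ?thesis
    by (simp add: convex_bodies_def compact_translation convex_translation del: image_add_0)
qed

text \<open>A convex set without interior lies in a hyperplane, and a hyperplane through 0 is a
  proper subspace. This turns volume conditions into conditions on spans, where dimensions can be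
  counted.\<close>

lemma measure_convex_body_eq_0_iff:
  fixes K :: "'a::euclidean_space set"
  assumes "K \<in> convex_bodies" "0 \<in> K"
  shows "measure lebesgue K = 0 \<longleftrightarrow> span K \<noteq> UNIV"
proof -
  have K: "compact K" "convex K" using assms by (auto simp: convex_bodies_def)
  have "measure lebesgue K = 0 \<longleftrightarrow> negligible K"
    using K by (simp add: negligible_iff_measure0 lmeasurable_compact)
  also have "\<dots> \<longleftrightarrow> span K \<noteq> UNIV"
  proof
    assume "negligible K"
    then have "interior K = {}" using K negligible_convex_interior by blast
    then obtain a b where ab: "a \<noteq> 0" "K \<subseteq> {x. a \<bullet> x = b}"
      using empty_interior_subset_hyperplane K by blast
    with assms(2) have "b = 0" by auto
    with ab have "span K \<subseteq> {x. a \<bullet> x = 0}"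
      by (intro span_minimal subspace_hyperplane) auto
    moreover have "a \<notin> {x. a \<bullet> x = 0}" using ab by simp
    ultimately show "span K \<noteq> UNIV" by blast
  next
    assume "span K \<noteq> UNIV"
    then have "dim K \<noteq> DIM('a)" using dim_eq_full by blast
    then show "negligible K"
      using dim_subset_UNIV[of K] by (intro negligible_lowdim) linarith
  qed
  finally show ?thesis .
qed

lemma zero_mem_sum_sets:
  fixes A :: "'b \<Rightarrow> 'a::comm_monoid_add set"
  assumes "\<And>i. i \<in> I \<Longrightarrow> 0 \<in> A i"
  shows "0 \<in> (\<Sum>i\<in>I. A i)"
  using assms
proof (induction I rule: infinite_finite_induct)
  case (insert i I)
  then show ?case using set_plus_intro[of 0 "A i" 0 "\<Sum>i\<in>I. A i"] by simp
qed auto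

text \<open>As every summand contains 0, the Minkowski sum contains each of them; conversely its
  elements are sums of elements of the union.\<close>

lemma span_sum_sets:
  fixes A :: "'b \<Rightarrow> 'a::real_vector set"
  assumes "finite I" "\<And>i. i \<in> I \<Longrightarrow> 0 \<in> A i"
  shows "span (\<Sum>i\<in>I. A i) = span (\<Union>i\<in>I. A i)"
  using assms
proof (induction I rule: finite_induct)
  case empty
  then show ?case by simp
next
  case (insert i I)
  have 0: "0 \<in> (\<Sum>i\<in>I. A i)" "0 \<in> A i"
    using zero_mem_sum_sets[of I A] insert by auto
  have IH: "span (\<Sum>i\<in>I. A i) = span (\<Union>i\<in>I. A i)" using insert by simp
  have "A i + (\<Sum>i\<in>I. A i) \<subseteq> span (A i \<union> (\<Sum>i\<in>I. A i))"
    by (intro subsetI, elim set_plus_elim) (auto intro: span_add span_base)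
  moreover have "A i \<union> (\<Sum>i\<in>I. A i) \<subseteq> A i + (\<Sum>i\<in>I. A i)"
    using set_plus_intro[OF _ 0(1), of _ "A i"] set_plus_intro[OF 0(2), of _ "\<Sum>i\<in>I. A i"] by auto
  ultimately have "span (A i + (\<Sum>i\<in>I. A i)) = span (A i \<union> (\<Sum>i\<in>I. A i))"
    by (metis span_eq span_superset subset_trans)
  also have "\<dots> = span (A i \<union> (\<Union>i\<in>I. A i))"
    using IH by (simp add: span_Un)
  finally show ?case using insert by simp
qed

lemma mem_sum_sets:
  fixes A :: "'b \<Rightarrow> 'a::comm_monoid_add set"
  assumes "finite I" "\<And>i. i \<in> I \<Longrightarrow> x i \<in> A i"
  shows "(\<Sum>i\<in>I. x i) \<in> (\<Sum>i\<in>I. A i)"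
  unfolding set_sum_alt[OF assms(1)] using assms(2) by (intro CollectI exI[of _ x]) simp

lemma difference_body_alt: "difference_body K = {x - y |x y. x \<in> K \<and> y \<in> K}"
  unfolding difference_body_def
proof safe
  fix z assume "z \<in> K + uminus ` K"
  then obtain x y where "x \<in> K" "y \<in> K" "z = x + - y" by (auto elim!: set_plus_elim)
  then show "\<exists>x y. z = x - y \<and> x \<in> K \<and> y \<in> K" by (intro exI[of _ x] exI[of _ y]) simp
next
  fix x y assume "x \<in> K" "y \<in> K"
  then show "x - y \<in> K + uminus ` K" using set_plus_intro[of x K "- y" "uminus ` K"] by simp
qed

lemma convex_bodies_difference_body:
  fixes K :: "'a::euclidean_space set"
  assumes "K \<in> convex_bodies"
  shows "difference_body K \<in> convex_bodies"
proof -
  have "uminus ` K \<in> convex_bodies"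
    using assms convex_negations[of K] compact_negations[of K] by (simp add: convex_bodies_def)
  with assms show ?thesis unfolding difference_body_def by (rule convex_bodies_plus)
qed

section \<open>Vectors and segments\<close>

lemma mem_centered_segment_iff:
  fixes c f :: "'a::real_vector"
  shows "x \<in> closed_segment (c - f) (c + f) \<longleftrightarrow> (\<exists>s. \<bar>s\<bar> \<le> 1 \<and> x = c + s *\<^sub>R f)"
proof
  assume "x \<in> closed_segment (c - f) (c + f)"
  then obtain u where u: "0 \<le> u" "u \<le> 1" "x = (1 - u) *\<^sub>R (c - f) + u *\<^sub>R (c + f)"
    by (auto simp: in_segment)
  then have "x = c + (2 * u - 1) *\<^sub>R f"
    by (simp add: algebra_simps scaleR_2[symmetric])
  with u show "\<exists>s. \<bar>s\<bar> \<le> 1 \<and> x = c + s *\<^sub>R f" by (intro exI[of _ "2 * u - 1"]) auto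
next
  assume "\<exists>s. \<bar>s\<bar> \<le> 1 \<and> x = c + s *\<^sub>R f"
  then obtain s where s: "\<bar>s\<bar> \<le> 1" "x = c + s *\<^sub>R f" by blast
  have "x = (1 - (s + 1) / 2) *\<^sub>R (c - f) + ((s + 1) / 2) *\<^sub>R (c + f)"
  proof -
    have "(1 - (s + 1) / 2) *\<^sub>R (c - f) + ((s + 1) / 2) *\<^sub>R (c + f)
      = ((1 - (s + 1) / 2) + (s + 1) / 2) *\<^sub>R c + ((s + 1) / 2 - (1 - (s + 1) / 2)) *\<^sub>R f"
      by (simp only: scaleR_add_left scaleR_diff_left scaleR_add_right scaleR_diff_right) simp
    also have "\<dots> = x" by (simp add: s(2) field_simps)
    finally show ?thesis by simp
  qed
  with s(1) show "x \<in> closed_segment (c - f) (c + f)"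
    unfolding in_segment by (intro exI[of _ "(s + 1) / 2"]) auto
qed

text \<open>Half the difference and half the sum of the coefficients of the two endpoints describe
  \<open>f3\<close> and \<open>c3\<close>. As \<open>\<bar>s - s'\<bar> + \<bar>s + s'\<bar>\<close>
  is twice the larger of the two moduli, stretching and shifting share one budget: a coefficient
  \<open>a\<close> of modulus 1 forces \<open>\<sigma> = 0\<close>.\<close>

lemma centered_segment_subset_plusE:
  fixes c1 f1 :: "'a::real_vector"
  assumes "closed_segment (c3 - f3) (c3 + f3)
      \<subseteq> closed_segment (c1 - f1) (c1 + f1) + closed_segment (c2 - f2) (c2 + f2)"
  obtains a b \<sigma> \<tau> where "f3 = a *\<^sub>R f1 + b *\<^sub>R f2" "c3 = c1 + c2 + \<sigma> *\<^sub>R f1 + \<tau> *\<^sub>R f2"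
    "\<bar>a\<bar> + \<bar>\<sigma>\<bar> \<le> 1" "\<bar>b\<bar> + \<bar>\<tau>\<bar> \<le> 1"
proof -
  have *: "\<exists>s t. \<bar>s\<bar> \<le> 1 \<and> \<bar>t\<bar> \<le> 1 \<and> x = (c1 + s *\<^sub>R f1) + (c2 + t *\<^sub>R f2)"
    if "x \<in> closed_segment (c3 - f3) (c3 + f3)" for x
    using subsetD[OF assms that] by (elim set_plus_elim) (auto simp: mem_centered_segment_iff)
  obtain s t where st: "\<bar>s\<bar> \<le> 1" "\<bar>t\<bar> \<le> 1" "c3 + f3 = (c1 + s *\<^sub>R f1) + (c2 + t *\<^sub>R f2)"
    using *[of "c3 + f3"] by auto
  obtain s' t' where st': "\<bar>s'\<bar> \<le> 1" "\<bar>t'\<bar> \<le> 1" "c3 - f3 = (c1 + s' *\<^sub>R f1) + (c2 + t' *\<^sub>R f2)"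
    using *[of "c3 - f3"] by auto
  have "2 *\<^sub>R f3 = (c3 + f3) - (c3 - f3)" by (simp add: scaleR_2)
  also have "\<dots> = (s - s') *\<^sub>R f1 + (t - t') *\<^sub>R f2"
    unfolding st(3) st'(3) by (simp add: algebra_simps)
  finally have "f3 = (1/2) *\<^sub>R ((s - s') *\<^sub>R f1 + (t - t') *\<^sub>R f2)" by (metis scaleR_half_double scaleR_2)
  then have 1: "f3 = ((s - s') / 2) *\<^sub>R f1 + ((t - t') / 2) *\<^sub>R f2"
    by (simp add: scaleR_add_right)
  have "2 *\<^sub>R c3 = (c3 + f3) + (c3 - f3)" by (simp add: scaleR_2)
  also have "\<dots> = 2 *\<^sub>R (c1 + c2) + (s + s') *\<^sub>R f1 + (t + t') *\<^sub>R f2"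
    unfolding st(3) st'(3) by (simp add: algebra_simps scaleR_2)
  finally have "c3 = (1/2) *\<^sub>R (2 *\<^sub>R (c1 + c2) + (s + s') *\<^sub>R f1 + (t + t') *\<^sub>R f2)"
    by (metis scaleR_half_double scaleR_2)
  then have 2: "c3 = c1 + c2 + ((s + s') / 2) *\<^sub>R f1 + ((t + t') / 2) *\<^sub>R f2"
    by (simp add: scaleR_add_right)
  show ?thesis
    by (rule that[OF 1 2]) (use st st' in \<open>auto simp: abs_if field_simps split: if_splits\<close>)
qed

lemma independent_pair_coeffs:
  fixes x y :: "'a::real_vector"
  assumes "y \<noteq> 0" "x \<notin> span {y}" "a *\<^sub>R x + b *\<^sub>R y = a' *\<^sub>R x + b' *\<^sub>R y"
  shows "a = a'" "b = b'"
proof -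
  have e: "(a - a') *\<^sub>R x = (b' - b) *\<^sub>R y"
    using assms(3) by (simp add: algebra_simps)
  show 1: "a = a'"
  proof (rule ccontr)
    assume "a \<noteq> a'"
    then have "x = (1 / (a - a')) *\<^sub>R ((a - a') *\<^sub>R x)" by simp
    then have "x = ((b' - b) / (a - a')) *\<^sub>R y" unfolding e by simp
    then show False using assms(2) by (auto simp: span_singleton)
  qed
  show "b = b'" using e 1 assms(1) by simp
qed

text \<open>Cauchy's equation on the half-line: nonnegativity makes \<open>N\<close> monotone, so
  \<open>N (n * t)\<close> lies between the values at consecutive integers enclosing
  \<open>n * t\<close>. The resulting error \<open>N 1\<close> is divided by
  \<open>n\<close>.\<close>

lemma additive_nonneg_imp_linear:
  fixes N :: "real \<Rightarrow> real"
  assumes add: "\<And>s t. 0 \<le> s \<Longrightarrow> 0 \<le> t \<Longrightarrow> N (s + t) = N s + N t"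
    and nn: "\<And>t. 0 \<le> N t" and t: "0 \<le> t"
  shows "N t = t * N 1"
proof -
  have N0: "N 0 = 0" using add[of 0 0] by simp
  have nat: "N (real k * s) = real k * N s" if "0 \<le> s" for k s
  proof (induction k)
    case (Suc k)
    have "N (real (Suc k) * s) = N (real k * s + s)" by (simp add: algebra_simps)
    also have "\<dots> = N (real k * s) + N s" using that by (intro add) auto
    finally show ?case using Suc by (simp add: algebra_simps)
  qed (simp add: N0)
  have mono: "N r \<le> N s" if "0 \<le> r" "r \<le> s" for r s
    using add[of r "s - r"] nn[of "s - r"] that by simp
  have "real n * \<bar>N t - t * N 1\<bar> \<le> N 1" for n
  proof -
    define k where "k = nat \<lfloor>real n * t\<rfloor>"
    have k: "real k \<le> real n * t" "real n * t \<le> real (Suc k)"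
      using t unfolding k_def by (auto simp: of_nat_nat) linarith
    have "N (real k * 1) \<le> N (real n * t)" "N (real n * t) \<le> N (real (Suc k) * 1)"
      using k t by (auto intro!: mono)
    then have "real k * N 1 \<le> real n * N t" "real n * N t \<le> real (Suc k) * N 1"
      using nat[OF t, of n] nat[of 1 k] nat[of 1 "Suc k"] by auto
    moreover have "real k * N 1 \<le> (real n * t) * N 1" "(real n * t) * N 1 \<le> real (Suc k) * N 1"
      using k nn[of 1] by (auto intro!: mult_right_mono)
    ultimately have "\<bar>real n * N t - (real n * t) * N 1\<bar> \<le> N 1"
      by (simp add: algebra_simps abs_le_iff)
    moreover have "real n * N t - (real n * t) * N 1 = real n * (N t - t * N 1)"
      by (simp add: algebra_simps)
    ultimately show ?thesis by (simp add: abs_mult)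
  qed
  then have "\<bar>N t - t * N 1\<bar> = 0"
    using real_archimedian_rdiv_eq_0[of "\<bar>N t - t * N 1\<bar>" "N 1"] nn by auto
  then show ?thesis by simp
qed

text \<open>On a line the norm determines a vector up to sign. This converts an equation of norms
  for the images of segments into one of vectors.\<close>

lemma collinear_norm_eq:
  fixes x y z :: "'a::real_normed_vector"
  assumes "x \<in> span {z}" "y \<in> span {z}" "norm x = \<bar>t\<bar> * norm y"
  shows "\<exists>s. \<bar>s\<bar> = 1 \<and> x = (s * t) *\<^sub>R y"
proof (cases "z = 0")
  case True
  then show ?thesis using assms by (auto simp: span_singleton intro: exI[of _ 1])
next
  case False
  obtain a b where ab: "x = a *\<^sub>R z" "y = b *\<^sub>R z" using assms by (auto simp: span_singleton)
  then have "\<bar>a\<bar> = \<bar>t * b\<bar>" using assms(3) False by (simp add: abs_mult)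
  then have "a = 1 * (t * b) \<or> a = -1 * (t * b)" by (auto simp: abs_eq_iff)
  then obtain s where "\<bar>s\<bar> = 1" "a = s * (t * b)" by (metis abs_1 abs_minus)
  then show ?thesis using ab by (intro exI[of _ s]) (auto simp: mult.assoc)
qed

section \<open>Maps that are additive up to signs\<close>

text \<open>Basis vectors are adjoined one at a time, and each use of \<open>add\<close> may flip
  the whole partial sum. The signs depend on \<open>x\<close>, so only the moduli of the coordinates
  are controlled.\<close>

lemma diagonal_signs:
  fixes f :: "'a::euclidean_space \<Rightarrow> 'a"
  assumes add: "\<And>v w. \<exists>s t. \<bar>s\<bar> = 1 \<and> \<bar>t\<bar> = 1 \<and> f (v + w) = s *\<^sub>R f v + t *\<^sub>R f w"
    and scale: "\<And>t v. \<exists>s. \<bar>s\<bar> = 1 \<and> f (t *\<^sub>R v) = (s * t) *\<^sub>R f v"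
    and basis: "\<And>b. b \<in> Basis \<Longrightarrow> \<exists>s. \<bar>s\<bar> = 1 \<and> f b = s *\<^sub>R b"
    and I: "finite I" "I \<subseteq> Basis"
  shows "\<exists>\<sigma>. (\<forall>b. \<bar>\<sigma> b\<bar> = 1) \<and> f (\<Sum>b\<in>I. x b *\<^sub>R b) = (\<Sum>b\<in>I. (\<sigma> b * x b) *\<^sub>R b)"
  using I
proof (induction I rule: finite_induct)
  case empty
  have "f 0 = 0" using scale[of 0 0] by auto
  then show ?case by (intro exI[of _ "\<lambda>_. 1"]) auto
next
  case (insert b I)
  then obtain \<sigma> where \<sigma>: "\<And>b. \<bar>\<sigma> b\<bar> = 1"
      "f (\<Sum>b\<in>I. x b *\<^sub>R b) = (\<Sum>b\<in>I. (\<sigma> b * x b) *\<^sub>R b)" by auto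
  obtain s t where st: "\<bar>s\<bar> = 1" "\<bar>t\<bar> = 1"
      "f (x b *\<^sub>R b + (\<Sum>b\<in>I. x b *\<^sub>R b)) = s *\<^sub>R f (x b *\<^sub>R b) + t *\<^sub>R f (\<Sum>b\<in>I. x b *\<^sub>R b)"
    using add by blast
  obtain s' where s': "\<bar>s'\<bar> = 1" "f (x b *\<^sub>R b) = (s' * x b) *\<^sub>R f b" using scale by blast
  obtain s'' where s'': "\<bar>s''\<bar> = 1" "f b = s'' *\<^sub>R b" using basis[of b] insert.prems by auto
  let ?\<sigma> = "\<lambda>c. if c = b then s * s' * s'' else t * \<sigma> c"
  have "(\<Sum>c\<in>I. (?\<sigma> c * x c) *\<^sub>R c) = (\<Sum>c\<in>I. (t * \<sigma> c * x c) *\<^sub>R c)"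
    using insert by (intro sum.cong) auto
  then have "f (\<Sum>b\<in>insert b I. x b *\<^sub>R b) = (\<Sum>c\<in>insert b I. (?\<sigma> c * x c) *\<^sub>R c)"
    using insert st \<sigma> s' s'' by (simp add: scaleR_sum_right mult.assoc mult.left_commute)
  moreover have "\<forall>c. \<bar>?\<sigma> c\<bar> = 1" using st \<sigma> s' s'' by (auto simp: abs_mult)
  ultimately show ?case by (intro exI[of _ ?\<sigma>] conjI)
qed

text \<open>The first three assumptions also hold for diagonal matrices with entries 1 and -1; it is
  \<open>star\<close> that ties the sign of each coordinate to that of the
  \<open>e\<close>-coordinate. Vectors without \<open>e\<close>-coordinate are reached through
  \<open>v + e\<close>.\<close>

lemma identity_up_to_sign:
  fixes f :: "'a::euclidean_space \<Rightarrow> 'a"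
  assumes add: "\<And>v w. \<exists>s t. \<bar>s\<bar> = 1 \<and> \<bar>t\<bar> = 1 \<and> f (v + w) = s *\<^sub>R f v + t *\<^sub>R f w"
    and scale: "\<And>t v. \<exists>s. \<bar>s\<bar> = 1 \<and> f (t *\<^sub>R v) = (s * t) *\<^sub>R f v"
    and basis: "\<And>b. b \<in> Basis \<Longrightarrow> \<exists>s. \<bar>s\<bar> = 1 \<and> f b = s *\<^sub>R b"
    and e: "e \<in> Basis"
    and star: "\<And>b. b \<in> Basis \<Longrightarrow> b \<noteq> e \<Longrightarrow> \<exists>s. \<bar>s\<bar> = 1 \<and> f (e + b) = s *\<^sub>R (e + b)"
  shows "\<exists>s. \<bar>s\<bar> = 1 \<and> f v = s *\<^sub>R v"
proof -
  have coord: "\<bar>f v \<bullet> b\<bar> = \<bar>v \<bullet> b\<bar>" if b: "b \<in> Basis" for v b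
  proof -
    obtain \<sigma> where \<sigma>: "\<And>b. \<bar>\<sigma> b\<bar> = 1"
        "f (\<Sum>b\<in>Basis. (v \<bullet> b) *\<^sub>R b) = (\<Sum>b\<in>Basis. (\<sigma> b * (v \<bullet> b)) *\<^sub>R b)"
      using diagonal_signs[OF add scale basis finite_Basis order_refl, of "\<lambda>b. v \<bullet> b"] by blast
    then have "f v = (\<Sum>b\<in>Basis. (\<sigma> b * (v \<bullet> b)) *\<^sub>R b)" by (simp add: euclidean_representation)
    then have "f v \<bullet> b = \<sigma> b * (v \<bullet> b)" using b by (simp add: inner_sum_left_Basis)
    then show ?thesis using \<sigma>(1) by (simp add: abs_mult)
  qed
  have main: "\<exists>s. \<bar>s\<bar> = 1 \<and> f v = s *\<^sub>R v" if ve: "v \<bullet> e \<noteq> 0" for v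
  proof -
    define s where "s = (f v \<bullet> e) / (v \<bullet> e)"
    have s: "\<bar>s\<bar> = 1" "f v \<bullet> e = s * (v \<bullet> e)"
      using coord[OF e, of v] ve unfolding s_def by auto
    have "f v \<bullet> b = s * (v \<bullet> b)" if b: "b \<in> Basis" for b
    proof (cases "b = e")
      case False
      have eb: "e \<bullet> e = 1" "b \<bullet> b = 1" "e \<bullet> b = 0" "b \<bullet> e = 0"
        using e b False by (auto simp: inner_Basis)
      \<comment> \<open>The vector \<open>w\<close> has no \<open>e\<close>-coordinate. This determines the sign \<open>r\<close> below, and the modulus
        of the \<open>b\<close>-coordinate of \<open>f w\<close> then shows that \<open>f\<close> changes both coordinates of \<open>v\<close> by the same sign.\<close>
      define w where "w = v + (- (v \<bullet> e)) *\<^sub>R (e + b)"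
      obtain p q where pq: "\<bar>p\<bar> = 1" "f w = p *\<^sub>R f v + q *\<^sub>R f ((- (v \<bullet> e)) *\<^sub>R (e + b))"
        unfolding w_def using add by blast
      obtain q' where q': "f ((- (v \<bullet> e)) *\<^sub>R (e + b)) = (q' * (- (v \<bullet> e))) *\<^sub>R f (e + b)"
        using scale by blast
      obtain q'' where q'': "f (e + b) = q'' *\<^sub>R (e + b)" using star[OF b False] by blast
      define r where "r = q * q' * q'' * (- (v \<bullet> e))"
      have fw: "f w = p *\<^sub>R f v + r *\<^sub>R (e + b)"
        using pq(2) unfolding q' q'' r_def by (simp add: ac_simps)
      have we: "w \<bullet> e = 0" and wb: "w \<bullet> b = v \<bullet> b - v \<bullet> e"
        using eb by (simp_all add: w_def inner_add_left inner_diff_left)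
      have "p * (f v \<bullet> e) + r = 0"
        using coord[OF e, of w] eb unfolding we by (simp add: fw inner_add_left)
      moreover have "\<bar>p * (f v \<bullet> b) + r\<bar> = \<bar>v \<bullet> b - v \<bullet> e\<bar>"
        using coord[OF b, of w] eb unfolding wb by (simp add: fw inner_add_left)
      ultimately have "\<bar>p * (f v \<bullet> b - f v \<bullet> e)\<bar> = \<bar>v \<bullet> b - v \<bullet> e\<bar>"
        by (simp add: right_diff_distrib add_eq_0_iff)
      then have "(f v \<bullet> b - f v \<bullet> e)\<^sup>2 = (v \<bullet> b - v \<bullet> e)\<^sup>2"
        using pq(1) by (metis abs_mult mult_1 power2_abs)
      moreover have "(f v \<bullet> b)\<^sup>2 = (v \<bullet> b)\<^sup>2" "(f v \<bullet> e)\<^sup>2 = (v \<bullet> e)\<^sup>2"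
        using coord[OF b, of v] coord[OF e, of v] by (metis power2_abs)+
      \<comment> \<open>The pure squares agree by \<open>coord\<close>, so expanding leaves only the
        mixed products.\<close>
      ultimately have "(f v \<bullet> b) * (f v \<bullet> e) = (v \<bullet> b) * (v \<bullet> e)"
        by (simp add: power2_diff)
      then have "(s * (f v \<bullet> b)) * (v \<bullet> e) = (v \<bullet> b) * (v \<bullet> e)"
        unfolding s(2) by (simp add: ac_simps)
      then have "s * (f v \<bullet> b) = v \<bullet> b" using ve by simp
      moreover have "s * s = 1" using s(1) by (metis abs_mult_self_eq mult_1)
      ultimately show ?thesis by (metis mult.assoc mult_1)
    qed (use s in simp)
    then have "f v = s *\<^sub>R v" by (subst euclidean_eq_iff) simp
    with s show ?thesis by blast
  qed
  show ?thesis
  proof (cases "v \<bullet> e = 0")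
    case True
    \<comment> \<open>\<open>main\<close> applies to \<open>v + e\<close>; comparing
      \<open>e\<close>-coordinates afterwards removes the multiple of \<open>e\<close>.\<close>
    have "(v + e) \<bullet> e \<noteq> 0" using True e by (simp add: inner_add_left)
    then obtain s where s: "\<bar>s\<bar> = 1" "f (v + e) = s *\<^sub>R (v + e)" using main by blast
    obtain p q where pq: "\<bar>p\<bar> = 1" "f (v + e) = p *\<^sub>R f v + q *\<^sub>R f e" using add by blast
    obtain q' where q': "f e = q' *\<^sub>R e" using basis[OF e] by blast
    have eq: "s *\<^sub>R (v + e) = p *\<^sub>R f v + (q * q') *\<^sub>R e" using s pq q' by simp
    have "s *\<^sub>R (v + e) \<bullet> e = (p *\<^sub>R f v + (q * q') *\<^sub>R e) \<bullet> e" unfolding eq ..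
    moreover have "f v \<bullet> e = 0" using coord[OF e, of v] True by simp
    ultimately have "s = q * q'" using True e by (simp add: inner_add_left)
    with eq have "p *\<^sub>R f v = s *\<^sub>R v" by (simp add: scaleR_add_right)
    then have "(p * p) *\<^sub>R f v = (p * s) *\<^sub>R v" by (metis scaleR_scaleR)
    moreover have "p * p = 1" using pq(1) by (metis abs_mult_self_eq mult_1)
    ultimately have "f v = (p * s) *\<^sub>R v" by simp
    then show ?thesis using s pq by (intro exI[of _ "p * s"]) (simp add: abs_mult)
  qed (use main in blast)
qed

section \<open>Monotone endomorphisms\<close>

text \<open>The two bounds of (VC) are condensed into \<open>null_iff\<close>: zero volume is
  preserved in both directions, which is a statement about dimension.\<close>

locale monotone_endomorphism =
  fixes \<Phi> :: "'a::euclidean_space set \<Rightarrow> 'a set"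
  assumes maps: "K \<in> convex_bodies \<Longrightarrow> \<Phi> K \<in> convex_bodies"
    and add: "K \<in> convex_bodies \<Longrightarrow> L \<in> convex_bodies \<Longrightarrow> \<Phi> (K + L) = \<Phi> K + \<Phi> L"
    and translate: "K \<in> convex_bodies \<Longrightarrow> \<Phi> ((\<lambda>x. x + t) ` K) = \<Phi> K"
    and mono: "K \<in> convex_bodies \<Longrightarrow> L \<in> convex_bodies \<Longrightarrow> K \<subseteq> L \<Longrightarrow> \<Phi> K \<subseteq> \<Phi> L"
    and null_iff: "K \<in> convex_bodies \<Longrightarrow> measure lebesgue (\<Phi> K) = 0 \<longleftrightarrow> measure lebesgue K = 0"
    and dim_ge_2: "DIM('a) \<ge> 2"
begin

abbreviation S :: "'a \<Rightarrow> 'a set" where "S v \<equiv> closed_segment 0 v"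

text \<open>Additivity makes \<open>\<Phi> {0}\<close> closed under doubling, so an element of
  maximal norm must be 0.\<close>

lemma map_zero: "\<Phi> {0} = {0}"
proof -
  have z: "{0::'a} \<in> convex_bodies" by (simp add: convex_bodies_def)
  then have P: "compact (\<Phi> {0})" "\<Phi> {0} \<noteq> {}" using maps by (auto simp: convex_bodies_def)
  then obtain x where x: "x \<in> \<Phi> {0}" "\<And>y. y \<in> \<Phi> {0} \<Longrightarrow> norm y \<le> norm x"
    using continuous_attains_sup[of "\<Phi> {0}" norm] by (auto simp: continuous_on_norm)
  have "{0::'a} + {0} = {0}" by (auto simp: set_plus_def)
  then have "\<Phi> {0} = \<Phi> {0} + \<Phi> {0}" using add[OF z z] by simp
  then have "x + x \<in> \<Phi> {0}" using x(1) set_plus_intro by blast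
  then have "norm (2 *\<^sub>R x) \<le> norm x" using x(2) by (metis scaleR_2)
  then have "norm x = 0" by simp
  then show ?thesis using x P by fastforce
qed

section \<open>Images of segments: counting dimensions\<close>

lemma zero_mem:
  assumes "K \<in> convex_bodies" "0 \<in> K"
  shows "0 \<in> \<Phi> K"
  using mono[of "{0}" K] assms map_zero by (auto simp: convex_bodies_def)

lemma map_sum:
  assumes "finite I" "\<And>i. i \<in> I \<Longrightarrow> A i \<in> convex_bodies"
  shows "\<Phi> (\<Sum>i\<in>I. A i) = (\<Sum>i\<in>I. \<Phi> (A i))"
  using assms
  by (induction I rule: finite_induct) (auto simp: map_zero add convex_bodies_sum)

text \<open>A zonotope and its image both contain 0, so for each of them spanning the space means
  positive volume, and \<open>null_iff\<close> compares the volumes. Additivity resolves the image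
  into images of segments.\<close>

lemma span_map_segments_eq_UNIV_iff:
  assumes "finite V"
  shows "span (\<Union>v\<in>V. \<Phi> (S v)) = UNIV \<longleftrightarrow> span V = UNIV"
proof -
  let ?Z = "\<Sum>v\<in>V. S v"
  have Z: "?Z \<in> convex_bodies" "0 \<in> ?Z"
    by (auto intro!: convex_bodies_sum convex_bodies_segment zero_mem_sum_sets)
  have "span (\<Union>v\<in>V. \<Phi> (S v)) = span (\<Phi> ?Z)"
    by (simp add: map_sum[OF assms convex_bodies_segment] span_sum_sets assms zero_mem convex_bodies_segment)
  moreover have "span (\<Phi> ?Z) = UNIV \<longleftrightarrow> span ?Z = UNIV"
    using measure_convex_body_eq_0_iff[OF Z] null_iff[OF Z(1)]
      measure_convex_body_eq_0_iff[OF maps[OF Z(1)] zero_mem[OF Z]] by argo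
  moreover have "span ?Z = span V"
  proof -
    have "span ?Z = span (\<Union>v\<in>V. S v)" by (simp add: span_sum_sets assms)
    also have "\<dots> = span V"
      unfolding span_eq
    proof
      show "(\<Union>v\<in>V. S v) \<subseteq> span V"
        by (auto simp: in_segment intro!: span_scale intro: span_base)
      show "V \<subseteq> span (\<Union>v\<in>V. S v)"
        by (intro subsetI span_base UN_I[of _ V]) auto
    qed
    finally show ?thesis .
  qed
  ultimately show ?thesis by simp
qed

text \<open>If one image held two independent vectors, a basis taken from images of segments would
  come from fewer than n segments, n being the dimension. But the images of fewer than n segments
  cannot span.\<close>

lemma map_segment_subset_span:
  assumes "p \<in> \<Phi> (S v)" "p \<noteq> 0"
  shows "\<Phi> (S v) \<subseteq> span {p}"
proof (rule ccontr)
  assume "\<not> \<Phi> (S v) \<subseteq> span {p}"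
  then obtain q where q: "q \<in> \<Phi> (S v)" "q \<notin> span {p}" by blast
  have ind: "independent {q, p}" "q \<noteq> p"
    using q assms span_base[of p "{p}"] by (auto simp: independent_insert)
  \<comment> \<open>The images over \<open>Basis\<close> already span, so this set contains a basis
    \<open>C\<close> extending \<open>q\<close> and \<open>p\<close>.\<close>
  let ?U = "{q, p} \<union> (\<Union>b\<in>Basis. \<Phi> (S b))"
  obtain C where C: "{q, p} \<subseteq> C" "C \<subseteq> ?U" "independent C" "?U \<subseteq> span C"
    using maximal_independent_subset_extend[of "{q, p}" ?U] ind(1) by blast
  have "span (\<Union>b\<in>Basis. \<Phi> (S b)) = UNIV"
    by (subst span_map_segments_eq_UNIV_iff) (auto simp: span_Basis)
  then have spC: "span C = UNIV"
    using C(4) span_minimal[of "\<Union>b\<in>Basis. \<Phi> (S b)" "span C"] by auto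
  have cC: "card C = DIM('a)" "finite C"
    using dim_span_eq_card_independent[OF C(3)] independent_imp_finite[OF C(3)] spC by simp_all
  have "\<forall>c\<in>C - {q, p}. \<exists>b\<in>Basis. c \<in> \<Phi> (S b)" using C(2) by blast
  then obtain b where b: "\<And>c. c \<in> C - {q, p} \<Longrightarrow> c \<in> \<Phi> (S (b c))" by metis
  \<comment> \<open>The single vector \<open>v\<close> accounts for both \<open>q\<close> and
    \<open>p\<close>, so \<open>?V\<close> has at most n - 1 elements.\<close>
  let ?V = "insert v (b ` (C - {q, p}))"
  have fV: "finite ?V" using cC by simp
  have "C \<subseteq> (\<Union>v\<in>?V. \<Phi> (S v))" using b q assms by auto
  then have "span (\<Union>v\<in>?V. \<Phi> (S v)) = UNIV"
    using spC by (metis span_mono top.extremum_uniqueI)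
  then have "span ?V = UNIV" using span_map_segments_eq_UNIV_iff[OF fV] by simp
  then have "DIM('a) \<le> card ?V"
    using dim_le_card[of UNIV ?V] fV by simp
  moreover have "card ?V \<le> Suc (card (C - {q, p}))"
    by (metis card_image_le card_insert_if cC(2) finite_Diff finite_imageI le_SucI Suc_le_mono)
  moreover have "card (C - {q, p}) = card C - 2"
    using C(1) ind(2) by (subst card_Diff_subset) auto
  ultimately show False using cC dim_ge_2 by linarith
qed

text \<open>A compact convex subset of a line is a segment. As this one contains 0, its midpoint
  \<open>c\<close> is a multiple of the half-vector \<open>f\<close>, so the whole image lies in the
  span of \<open>f\<close>.\<close>

lemma map_segment_ex:
  "\<exists>c f. \<Phi> (S v) = closed_segment (c - f) (c + f) \<and> \<Phi> (S v) \<subseteq> span {f}"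
proof -
  have cb: "\<Phi> (S v) \<in> convex_bodies" by (simp add: maps convex_bodies_segment)
  have 0: "0 \<in> \<Phi> (S v)" by (simp add: zero_mem convex_bodies_segment)
  obtain p where p: "\<Phi> (S v) \<subseteq> span {p}"
  proof (cases "\<Phi> (S v) \<subseteq> {0}")
    case True
    then have "\<Phi> (S v) \<subseteq> span {0}" using span_base[of 0 "{0}"] by blast
    then show ?thesis by (rule that)
  next
    case False
    then show ?thesis using map_segment_subset_span that by blast
  qed
  have "collinear (\<Phi> (S v))"
    unfolding collinear_def
  proof (intro exI[of _ p] ballI)
    fix x y assume "x \<in> \<Phi> (S v)" "y \<in> \<Phi> (S v)"
    then have "x - y \<in> span {p}" using p by (blast intro: span_diff)
    then show "\<exists>c. x - y = c *\<^sub>R p" by (auto simp: span_singleton)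
  qed
  then obtain a b where ab: "\<Phi> (S v) = closed_segment a b"
    using compact_convex_collinear_segment cb by (metis (mono_tags, lifting) convex_bodies_def mem_Collect_eq)
  define c f where "c = (1/2) *\<^sub>R (a + b)" and "f = (1/2) *\<^sub>R (b - a)"
  have cf: "a = c - f" "b = c + f"
    unfolding c_def f_def by (simp_all add: algebra_simps flip: scaleR_add_left)
  obtain t where t: "0 = (1 - t) *\<^sub>R (c - f) + t *\<^sub>R (c + f)"
    using 0 unfolding ab cf by (auto simp: in_segment)
  then have c: "c = (1 - 2 * t) *\<^sub>R f"
    by (simp add: algebra_simps scaleR_2[symmetric] scaleR_2)
  have "\<Phi> (S v) \<subseteq> span {f}"
    unfolding ab cf by (auto simp: in_segment c intro!: span_add span_diff span_scale intro: span_base)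
  then show ?thesis using ab cf by blast
qed

text \<open>An independent set extends to a basis \<open>W\<close>. The images of the segments over
  \<open>W\<close> span, hence so do their directions, and a spanning family of n vectors is
  injective and independent.\<close>

lemma directions_independent:
  assumes f: "\<And>v. \<Phi> (S v) \<subseteq> span {f v}" and V: "independent V"
  shows "independent (f ` V) \<and> inj_on f V"
proof -
  obtain W where W: "V \<subseteq> W" "independent W" "UNIV \<subseteq> span W"
    using maximal_independent_subset_extend[of V UNIV] V by auto
  have finW: "finite W" using W independent_imp_finite by blast
  have cW: "card W = DIM('a)"
    using dim_span_eq_card_independent[OF W(2)] W(3) by (metis dim_UNIV top.extremum_unique)
  have "span (\<Union>v\<in>W. \<Phi> (S v)) = UNIV"
    using span_map_segments_eq_UNIV_iff[OF finW] W(3) by (simp add: top.extremum_unique)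
  moreover have "(\<Union>v\<in>W. \<Phi> (S v)) \<subseteq> span (f ` W)"
  proof (rule UN_least)
    fix v assume "v \<in> W"
    then have "span {f v} \<subseteq> span (f ` W)" by (intro span_mono) auto
    with f show "\<Phi> (S v) \<subseteq> span (f ` W)" by blast
  qed
  ultimately have sp: "span (f ` W) = UNIV" using span_minimal[OF _ subspace_span] by blast
  have le: "card (f ` W) \<le> DIM('a)" using card_image_le[OF finW, of f] cW by simp
  have ind: "independent (f ` W)"
    by (rule card_le_dim_spanning[of _ UNIV]) (use sp finW le in auto)
  have "card (f ` W) = card W"
    using dim_span_eq_card_independent[OF ind] sp cW by simp
  then have "inj_on f W" using finW eq_card_imp_inj_on by blast
  then show ?thesis
    using W(1) ind by (meson image_mono independent_mono inj_on_subset)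
qed

section \<open>Centres and signs of the image segments\<close>

lemma directions_independent_pair:
  assumes f: "\<And>v. \<Phi> (S v) \<subseteq> span {f v}" and vw: "w \<noteq> 0" "v \<notin> span {w}"
  shows "f w \<noteq> 0" "f v \<notin> span {f w}"
proof -
  have "independent {v, w}" "v \<noteq> w"
    using vw span_base[of w "{w}"] by (auto simp: independent_insert)
  with directions_independent[OF f, of "{v, w}"]
  have "independent {f v, f w}" "f v \<noteq> f w" by auto
  then show "f w \<noteq> 0" "f v \<notin> span {f w}"
    by (auto simp: independent_insert split: if_splits)
qed

text \<open>Each side of a triangle lies in a translate of the sum of the other two. Combining the
  three inclusions after applying \<open>\<Phi>\<close> makes products of coefficients of modulus at
  most 1 equal to 1. All coefficients then have modulus 1, which leaves no room for a shift of the
  centres.\<close>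

lemma segment_sum_triangle:
  assumes f: "\<And>v. \<Phi> (S v) = closed_segment (c v - f v) (c v + f v)"
      "\<And>v. \<Phi> (S v) \<subseteq> span {f v}"
    and vw: "w \<noteq> 0" "v \<notin> span {w}"
  shows "c v = 0" "\<exists>s t. \<bar>s\<bar> = 1 \<and> \<bar>t\<bar> = 1 \<and> f (v + w) = s *\<^sub>R f v + t *\<^sub>R f w"
proof -
  note ind = independent_pair_coeffs[OF directions_independent_pair[of f, OF f(2) vw]]
  have sub3: "S (v + w) \<subseteq> S v + S w"
    by (auto simp: in_segment scaleR_add_right intro!: set_plus_intro) blast+
  \<comment> \<open>The translate of \<open>S x\<close> is the side from \<open>y\<close> to
    \<open>x + y\<close> in the triangle with vertices 0, \<open>y\<close> and
    \<open>x + y\<close>.\<close>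
  have tr: "(\<lambda>x. x + y) ` S x \<subseteq> S (x + y) + S y" for x y :: 'a
  proof safe
    fix z assume "z \<in> S x"
    then obtain u where u: "0 \<le> u" "u \<le> 1" "z = u *\<^sub>R x" by (auto simp: in_segment)
    then have "z + y = u *\<^sub>R (x + y) + (1 - u) *\<^sub>R y" by (simp add: algebra_simps)
    also have "\<dots> \<in> S (x + y) + S y"
      using u by (intro set_plus_intro) (auto simp: in_segment intro: exI[of _ "1 - u"])
    finally show "z + y \<in> S (x + y) + S y" .
  qed
  have "\<Phi> (S x) \<subseteq> \<Phi> (S (x + y)) + \<Phi> (S y)" for x y
    using mono[OF _ _ tr[of y x]] translate[of "S x" y]
    by (simp add: convex_bodies_segment convex_bodies_plus convex_bodies_translate flip: add)
  from this[of v w] this[of w v]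
  have s1: "\<Phi> (S v) \<subseteq> \<Phi> (S (v + w)) + \<Phi> (S w)"
    and s2: "\<Phi> (S w) \<subseteq> \<Phi> (S (v + w)) + \<Phi> (S v)" by (simp_all add: add.commute)
  have s3: "\<Phi> (S (v + w)) \<subseteq> \<Phi> (S v) + \<Phi> (S w)"
    using mono[OF _ _ sub3] by (simp add: convex_bodies_segment convex_bodies_plus add)
  obtain a b \<sigma> \<tau> where 3: "f (v + w) = a *\<^sub>R f v + b *\<^sub>R f w"
      "c (v + w) = c v + c w + \<sigma> *\<^sub>R f v + \<tau> *\<^sub>R f w" "\<bar>a\<bar> + \<bar>\<sigma>\<bar> \<le> 1" "\<bar>b\<bar> + \<bar>\<tau>\<bar> \<le> 1"
    using centered_segment_subset_plusE[OF s3[unfolded f]] by blast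
  obtain a1 b1 \<sigma>1 \<tau>1 where 1: "f v = a1 *\<^sub>R f (v + w) + b1 *\<^sub>R f w"
      "c v = c (v + w) + c w + \<sigma>1 *\<^sub>R f (v + w) + \<tau>1 *\<^sub>R f w" "\<bar>a1\<bar> + \<bar>\<sigma>1\<bar> \<le> 1" "\<bar>b1\<bar> + \<bar>\<tau>1\<bar> \<le> 1"
    using centered_segment_subset_plusE[OF s1[unfolded f]] by blast
  obtain a2 b2 \<sigma>2 \<tau>2 where 2: "f w = a2 *\<^sub>R f (v + w) + b2 *\<^sub>R f v"
      "c w = c (v + w) + c v + \<sigma>2 *\<^sub>R f (v + w) + \<tau>2 *\<^sub>R f v" "\<bar>a2\<bar> + \<bar>\<sigma>2\<bar> \<le> 1" "\<bar>b2\<bar> + \<bar>\<tau>2\<bar> \<le> 1"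
    using centered_segment_subset_plusE[OF s2[unfolded f]] by blast
  have unit: "\<bar>x\<bar> = 1 \<and> \<bar>y\<bar> = 1" if "x * y = 1" "\<bar>x\<bar> \<le> 1" "\<bar>y\<bar> \<le> 1" for x y :: real
  proof -
    have "\<bar>x\<bar> * \<bar>y\<bar> = 1" using that(1) by (metis abs_mult abs_1)
    then show ?thesis
      using that mult_left_le[of "\<bar>y\<bar>" "\<bar>x\<bar>"] mult_left_le[of "\<bar>x\<bar>" "\<bar>y\<bar>"]
      by (auto simp: mult.commute)
  qed
  have "1 *\<^sub>R f v + 0 *\<^sub>R f w = (a1 * a) *\<^sub>R f v + (a1 * b + b1) *\<^sub>R f w"
    using 1(1) unfolding 3(1) by (simp add: algebra_simps)
  from ind[OF this] have e1: "a1 * a = 1" "a1 * b + b1 = 0" by simp_all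
  have "0 *\<^sub>R f v + 1 *\<^sub>R f w = (a2 * a + b2) *\<^sub>R f v + (a2 * b) *\<^sub>R f w"
    using 2(1) unfolding 3(1) by (simp add: algebra_simps)
  from ind[OF this] have e2: "a2 * b = 1" "a2 * a + b2 = 0" by simp_all
  have "\<bar>a\<bar> \<le> 1" "\<bar>b\<bar> \<le> 1" "\<bar>a1\<bar> \<le> 1" "\<bar>a2\<bar> \<le> 1"
    using 1(3) 2(3) 3(3,4) by linarith+
  then have u: "\<bar>a1\<bar> = 1" "\<bar>a\<bar> = 1" "\<bar>a2\<bar> = 1" "\<bar>b\<bar> = 1"
    using unit[OF e1(1)] unit[OF e2(1)] by simp_all
  have "b1 = - (a1 * b)" "b2 = - (a2 * a)" using e1(2) e2(2) by simp_all
  then have u': "\<bar>b1\<bar> = 1" "\<bar>b2\<bar> = 1" using u by (simp_all add: abs_mult)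
  have z: "\<sigma> = 0" "\<tau> = 0" "\<sigma>1 = 0" "\<tau>1 = 0" "\<sigma>2 = 0" "\<tau>2 = 0"
    using u u' 1(3,4) 2(3,4) 3(3,4) by simp_all
  \<comment> \<open>Without shifts the relations between the centres are exact, and two of them
    already force \<open>c v + c v = 0\<close>.\<close>
  have "c (v + w) = c v + c w" using 3(2) unfolding z by simp
  moreover have "c w = c (v + w) + c v" using 2(2) unfolding z by simp
  ultimately have cw: "c w = (c v + c w) + c v" by metis
  have "2 *\<^sub>R c v = ((c v + c w) + c v) - c w" by (simp only: scaleR_2) simp
  also have "\<dots> = 0" by (simp only: cw[symmetric]) simp
  finally show "c v = 0" by simp
  show "\<exists>s t. \<bar>s\<bar> = 1 \<and> \<bar>t\<bar> = 1 \<and> f (v + w) = s *\<^sub>R f v + t *\<^sub>R f w"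
    using 3(1) u by blast
qed

lemma map_segment_symmetric:
  obtains f where "\<And>v. \<Phi> (S v) = closed_segment (- f v) (f v)"
    "\<And>v. \<Phi> (S v) \<subseteq> span {f v}"
    "\<And>v w. w \<noteq> 0 \<Longrightarrow> v \<notin> span {w} \<Longrightarrow>
        \<exists>s t. \<bar>s\<bar> = 1 \<and> \<bar>t\<bar> = 1 \<and> f (v + w) = s *\<^sub>R f v + t *\<^sub>R f w"
proof -
  obtain c f where f: "\<And>v. \<Phi> (S v) = closed_segment (c v - f v) (c v + f v)"
      "\<And>v. \<Phi> (S v) \<subseteq> span {f v}"
    using map_segment_ex by metis
  have c: "c v = 0" for v
  proof (cases "v = 0")
    case True
    have "closed_segment (c 0 - f 0) (c 0 + f 0) = {0}" using f(1)[of 0] map_zero by simp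
    then have "c 0 - f 0 = 0" "c 0 + f 0 = 0" by (metis ends_in_segment singletonD)+
    then have "2 *\<^sub>R c 0 = 0" by (metis add.right_neutral add_diff_eq diff_add_cancel scaleR_2 diff_eq_eq)
    with True show ?thesis by simp
  next
    case False
    \<comment> \<open>In dimension at least 2 some \<open>w\<close> lies off the line of
      \<open>v\<close>, and the triangle argument applies to this pair.\<close>
    have "dim {v} < DIM('a)" using dim_ge_2 dim_le_card'[of "{v}"] by simp
    then obtain w where w: "w \<notin> span {v}" using dim_eq_full[of "{v}"] by auto
    have "v \<notin> span {w}"
    proof
      assume "v \<in> span {w}"
      then obtain k where k: "v = k *\<^sub>R w" by (auto simp: span_singleton)
      with False have "w = (1 / k) *\<^sub>R v" by auto
      with w show False by (auto simp: span_singleton)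
    qed
    moreover have "w \<noteq> 0" using w span_zero by metis
    ultimately show ?thesis using segment_sum_triangle(1)[OF f] by blast
  qed
  show ?thesis
    by (rule that[of f]) (use f c segment_sum_triangle(2)[OF f] in auto)
qed

section \<open>Homogeneity and linearity of the directions\<close>

text \<open>Along a ray, segments add up as Minkowski sums, so the norm of
  \<open>f (t *\<^sub>R v)\<close> is additive in nonnegative \<open>t\<close> and therefore linear.
  Negative factors reduce to these since \<open>S (- v)\<close> is a translate of
  \<open>S v\<close>. The sign \<open>s\<close> appears because a segment determines its half-vector
  only up to sign.\<close>

lemma scale_directions:
  assumes f: "\<And>v. \<Phi> (S v) = closed_segment (- f v) (f v)"
  shows "\<exists>s. \<bar>s\<bar> = 1 \<and> f (t *\<^sub>R v) = (s * t) *\<^sub>R f v"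
proof -
  have mem: "x \<in> \<Phi> (S v) \<longleftrightarrow> (\<exists>s. \<bar>s\<bar> \<le> 1 \<and> x = s *\<^sub>R f v)" for x v
    using mem_centered_segment_iff[of x 0 "f v"] f by simp
  have fin: "f v \<in> \<Phi> (S v)" for v using f by simp
  have sub: "S (r *\<^sub>R v) \<subseteq> S (t *\<^sub>R v)" if "0 \<le> r" "r \<le> t" for r t v
  proof
    fix x assume "x \<in> S (r *\<^sub>R v)"
    then obtain u where u: "0 \<le> u" "u \<le> 1" "x = (u * r) *\<^sub>R v" by (auto simp: in_segment)
    show "x \<in> S (t *\<^sub>R v)"
    proof (cases "t = 0")
      case False
      have "u * r \<le> 1 * t" using u that by (intro mult_mono) auto
      then show ?thesis using u that False unfolding in_segment
        by (intro exI[of _ "u * r / t"]) (auto simp: field_simps)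
    qed (use that u in auto)
  qed
  have par: "\<exists>\<alpha>. \<bar>\<alpha>\<bar> \<le> 1 \<and> f (r *\<^sub>R v) = \<alpha> *\<^sub>R f (t *\<^sub>R v)" if "0 \<le> r" "r \<le> t" for r t v
    using mono[OF _ _ sub[OF that, of v]] fin[of "r *\<^sub>R v"] mem[of _ "t *\<^sub>R v"]
    by (auto simp: convex_bodies_segment)
  have Ssum: "S ((r + t) *\<^sub>R v) = S (r *\<^sub>R v) + S (t *\<^sub>R v)" if "0 \<le> r" "0 \<le> t" for r t v
  proof
    show "S ((r + t) *\<^sub>R v) \<subseteq> S (r *\<^sub>R v) + S (t *\<^sub>R v)"
      by (auto simp: in_segment algebra_simps intro!: set_plus_intro) blast+
    show "S (r *\<^sub>R v) + S (t *\<^sub>R v) \<subseteq> S ((r + t) *\<^sub>R v)"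
    proof (intro subsetI, elim set_plus_elim)
      fix x y z assume "x = y + z" "y \<in> S (r *\<^sub>R v)" "z \<in> S (t *\<^sub>R v)"
      then obtain a b where ab: "0 \<le> a" "a \<le> 1" "0 \<le> b" "b \<le> 1" "x = (a * r + b * t) *\<^sub>R v"
        by (auto simp: in_segment algebra_simps)
      then have "0 \<le> a * r + b * t" "a * r + b * t \<le> r + t"
        using that by (auto intro!: add_mono simp: mult_left_le_one_le)
      from sub[OF this, of v] show "x \<in> S ((r + t) *\<^sub>R v)" using ab by auto
    qed
  qed
  have N: "norm (f ((r + t) *\<^sub>R v)) = norm (f (r *\<^sub>R v)) + norm (f (t *\<^sub>R v))"
    if rt: "0 \<le> r" "0 \<le> t" for r t v
  proof -
    let ?x = "f (r *\<^sub>R v)" and ?y = "f (t *\<^sub>R v)" and ?z = "f ((r + t) *\<^sub>R v)"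
    have sum: "\<Phi> (S ((r + t) *\<^sub>R v)) = \<Phi> (S (r *\<^sub>R v)) + \<Phi> (S (t *\<^sub>R v))"
      by (simp add: Ssum[OF rt] add convex_bodies_segment)
    obtain \<alpha> \<beta> where ab: "?x = \<alpha> *\<^sub>R ?z" "?y = \<beta> *\<^sub>R ?z"
      using par[of r "r + t" v] par[of t "r + t" v] rt by auto
    have "?z \<in> \<Phi> (S (r *\<^sub>R v)) + \<Phi> (S (t *\<^sub>R v))" using fin sum by metis
    then obtain p q where pq: "\<bar>p\<bar> \<le> 1" "\<bar>q\<bar> \<le> 1" "?z = p *\<^sub>R ?x + q *\<^sub>R ?y"
      by (elim set_plus_elim) (auto simp: mem)
    have "norm ?z \<le> \<bar>p\<bar> * norm ?x + \<bar>q\<bar> * norm ?y"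
      by (subst pq(3)) (metis norm_scaleR norm_triangle_ineq)
    also have "\<dots> \<le> norm ?x + norm ?y"
      using pq by (intro add_mono) (auto simp: mult_left_le_one_le)
    finally have le: "norm ?z \<le> norm ?x + norm ?y" .
    \<comment> \<open>By symmetry about 0 both \<open>?x + ?y\<close> and \<open>?x - ?y\<close> lie
      in the sum. Both are used because the relative sign of \<open>\<alpha>\<close> and
      \<open>\<beta>\<close> is unknown: \<open>\<bar>\<alpha>\<bar> + \<bar>\<beta>\<bar>\<close>
      is the larger of \<open>\<bar>\<alpha> + \<beta>\<bar>\<close> and
      \<open>\<bar>\<alpha> - \<beta>\<bar>\<close>.\<close>
    have my: "- ?y \<in> \<Phi> (S (t *\<^sub>R v))" by (auto simp: mem intro!: exI[of _ "-1"])
    have "?x + ?y \<in> \<Phi> (S ((r + t) *\<^sub>R v))" "?x + - ?y \<in> \<Phi> (S ((r + t) *\<^sub>R v))"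
      unfolding sum by (intro set_plus_intro fin my)+
    then have nz: "norm (?x + ?y) \<le> norm ?z" "norm (?x + - ?y) \<le> norm ?z"
      by (auto simp: mem mult_left_le_one_le)
    have "?x + ?y = (\<alpha> + \<beta>) *\<^sub>R ?z" "?x + - ?y = (\<alpha> - \<beta>) *\<^sub>R ?z"
      using ab by (metis scaleR_add_left, metis diff_conv_add_uminus scaleR_diff_left)
    then have "\<bar>\<alpha> + \<beta>\<bar> * norm ?z \<le> norm ?z" "\<bar>\<alpha> - \<beta>\<bar> * norm ?z \<le> norm ?z"
      using nz by simp_all
    then have "(\<bar>\<alpha>\<bar> + \<bar>\<beta>\<bar>) * norm ?z \<le> norm ?z"
      by (auto simp: abs_if split: if_splits)
    then have "norm ?x + norm ?y \<le> norm ?z" using ab by (metis distrib_right norm_scaleR)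
    with le show ?thesis by simp
  qed
  have nonneg: "\<exists>s. \<bar>s\<bar> = 1 \<and> f (t *\<^sub>R v) = (s * t) *\<^sub>R f v" if t: "0 \<le> t" for t v
  proof -
    have "norm (f (t *\<^sub>R v)) = t * norm (f (1 *\<^sub>R v))"
      by (rule additive_nonneg_imp_linear[where N = "\<lambda>t. norm (f (t *\<^sub>R v))"]) (use t N in auto)
    then have n: "norm (f (t *\<^sub>R v)) = \<bar>t\<bar> * norm (f v)" using t by simp
    \<comment> \<open>The segments of \<open>t *\<^sub>R v\<close> and \<open>v\<close> both lie in
      that of \<open>?m *\<^sub>R v\<close>, which puts their directions on a common line.\<close>
    let ?m = "max 1 t"
    have "f (t *\<^sub>R v) \<in> span {f (?m *\<^sub>R v)}" "f (1 *\<^sub>R v) \<in> span {f (?m *\<^sub>R v)}"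
      using par[of t ?m v] par[of 1 ?m v] t by (auto simp: span_singleton)
    then show ?thesis using collinear_norm_eq n by (metis scaleR_one)
  qed
  have neg: "\<exists>s. \<bar>s\<bar> = 1 \<and> f (- v) = s *\<^sub>R f v" for v
  proof -
    have "(\<lambda>x. x + v) ` S (- v) = S v"
      using closed_segment_translation[of v 0 "- v"] by (simp add: add.commute closed_segment_commute)
    then have "\<Phi> (S (- v)) = \<Phi> (S v)"
      using translate[of "S (- v)" v] by (simp add: convex_bodies_segment)
    then have "{- f (- v), f (- v)} = {- f v, f v}" using f[of v] f[of "- v"]
      by (metis closed_segment_eq)
    then have "f (- v) = 1 *\<^sub>R f v \<or> f (- v) = (-1) *\<^sub>R f v" by (auto simp: doubleton_eq_iff)
    then show ?thesis by (metis abs_1 abs_minus)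
  qed
  show ?thesis
  proof (cases "0 \<le> t")
    case False
    obtain s where s: "\<bar>s\<bar> = 1" "f ((- t) *\<^sub>R (- v)) = (s * - t) *\<^sub>R f (- v)"
      using nonneg[of "- t" "- v"] False by auto
    obtain s' where s': "\<bar>s'\<bar> = 1" "f (- v) = s' *\<^sub>R f v" using neg by blast
    show ?thesis using s s' by (intro exI[of _ "- (s * s')"]) (auto simp: abs_mult ac_simps)
  qed (use nonneg in blast)
qed

text \<open>Since each \<open>f v\<close> carries an arbitrary sign, \<open>g\<close> is built from
  the values on \<open>Basis\<close> only, with signs calibrated by the vectors
  \<open>e + b\<close>. Then \<open>identity_up_to_sign\<close> shows that \<open>inv g\<close>
  undoes \<open>f\<close> up to sign.\<close>

lemma map_segment_linear:
  obtains g where "linear g" "inj g" "\<And>v. \<Phi> (S v) = closed_segment (- g v) (g v)"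
proof -
  obtain f where f: "\<And>v. \<Phi> (S v) = closed_segment (- f v) (f v)"
      "\<And>v. \<Phi> (S v) \<subseteq> span {f v}"
      "\<And>v w. w \<noteq> 0 \<Longrightarrow> v \<notin> span {w} \<Longrightarrow>
          \<exists>s t. \<bar>s\<bar> = 1 \<and> \<bar>t\<bar> = 1 \<and> f (v + w) = s *\<^sub>R f v + t *\<^sub>R f w"
    using map_segment_symmetric by metis
  have scale: "\<exists>s. \<bar>s\<bar> = 1 \<and> f (t *\<^sub>R v) = (s * t) *\<^sub>R f v" for t v
    using scale_directions[OF f(1)] .
  have add: "\<exists>s t. \<bar>s\<bar> = 1 \<and> \<bar>t\<bar> = 1 \<and> f (v + w) = s *\<^sub>R f v + t *\<^sub>R f w" for v w
  proof (cases "v \<in> span {w}")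
    case False
    have "f 0 = 0" using scale[of 0 0] by auto
    then show ?thesis using f(3)[OF _ False] by (cases "w = 0") (auto intro!: exI[of _ 1])
  next
    \<comment> \<open>Collinear vectors are outside the triangle argument. Here all three values are
      multiples of \<open>f w\<close>, and \<open>scale\<close> gives the relation.\<close>
    case True
    then obtain k where k: "v = k *\<^sub>R w" by (auto simp: span_singleton)
    obtain s where s: "\<bar>s\<bar> = 1" "f ((k + 1) *\<^sub>R w) = (s * (k + 1)) *\<^sub>R f w" using scale by blast
    obtain s' where s': "\<bar>s'\<bar> = 1" "f (k *\<^sub>R w) = (s' * k) *\<^sub>R f w" using scale by blast
    have ss: "s' * s' = 1" using s'(1) by (metis abs_mult_self_eq mult_1)
    have "f (v + w) = (s * k) *\<^sub>R f w + s *\<^sub>R f w" using s k by (simp add: algebra_simps)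
    also have "(s * k) *\<^sub>R f w = (s * s') *\<^sub>R f v" 
    proof -
      have "(s * s') *\<^sub>R f v = (s * k * (s' * s')) *\<^sub>R f w" using s' k by (simp add: ac_simps)
      then show ?thesis using ss by simp
    qed
    finally show ?thesis using s s' by (intro exI[of _ "s * s'"] exI[of _ s]) (auto simp: abs_mult)
  qed
  obtain e :: 'a where e: "e \<in> Basis" by fastforce
  have "\<exists>r. \<bar>r\<bar> = 1 \<and> (\<exists>s. \<bar>s\<bar> = 1 \<and> f (e + b) = s *\<^sub>R (f e + r *\<^sub>R f b))" for b
  proof -
    obtain s t where st: "\<bar>s\<bar> = 1" "\<bar>t\<bar> = 1" "f (e + b) = s *\<^sub>R f e + t *\<^sub>R f b"
      using add by blast
    have ss: "s * s = 1" using st(1) by (metis abs_mult_self_eq mult_1)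
    have "f (e + b) = s *\<^sub>R (f e + (s * t) *\<^sub>R f b)"
      using st(3) ss by (simp add: scaleR_add_right mult.assoc[symmetric])
    then show ?thesis using st by (intro exI[of _ "s * t"]) (auto simp: abs_mult)
  qed
  then obtain r where r: "\<And>b. \<bar>r b\<bar> = 1"
      "\<And>b. \<exists>s. \<bar>s\<bar> = 1 \<and> f (e + b) = s *\<^sub>R (f e + r b *\<^sub>R f b)" by metis
  \<comment> \<open>Signs are normalised so that \<open>f (e + b)\<close> is \<open>p e + p b\<close> up to sign.\<close>
  define p where "p = (\<lambda>b. if b = e then f e else r b *\<^sub>R f b)"
  define g where "g = (\<lambda>x::'a. \<Sum>b\<in>Basis. (x \<bullet> b) *\<^sub>R p b)"
  have lin: "linear g"
    unfolding g_def
    by (intro linearI) (simp_all add: inner_add_left scaleR_add_left sum.distrib scaleR_sum_right)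
  have gb: "g b = p b" if "b \<in> Basis" for b
  proof -
    have "g b = (\<Sum>c\<in>Basis. if c = b then p b else 0)"
      unfolding g_def using that by (intro sum.cong) (auto simp: inner_Basis)
    then show ?thesis using that by simp
  qed
  have pf: "\<exists>s. \<bar>s\<bar> = 1 \<and> f b = s *\<^sub>R p b" for b
  proof (cases "b = e")
    case False
    have "r b * r b = 1" using r(1)[of b] by (metis abs_mult_self_eq mult_1)
    with False show ?thesis using r(1) by (intro exI[of _ "r b"]) (auto simp: p_def)
  qed (auto simp: p_def intro!: exI[of _ 1])
  have "independent (f ` Basis)" "inj_on f (Basis :: 'a set)"
    using directions_independent[OF f(2), of Basis] independent_Basis by auto
  then have "span (f ` Basis) = UNIV"
    using dim_eq_full[of "f ` Basis"] by (simp add: dim_eq_card_independent card_image)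
  moreover have "f ` Basis \<subseteq> range g"
  proof safe
    fix b :: 'a assume b: "b \<in> Basis"
    obtain s where "f b = s *\<^sub>R p b" using pf by blast
    then have "f b = g (s *\<^sub>R b)" using gb[OF b] lin by (simp add: linear_scale)
    then show "f b \<in> range g" by simp
  qed
  ultimately have "range g = UNIV"
    using span_minimal[of "f ` Basis" "range g"] linear_subspace_image[OF lin subspace_UNIV] by auto
  then have surj: "surj g" .
  then have inj: "inj g" using lin linear_surjective_imp_injective by blast
  define h where "h = inv g \<circ> f"
  have gh: "g (h v) = f v" for v unfolding h_def using surj by (simp add: surj_f_inv_f)
  have eqI: "h v = x" if "f v = g x" for v x
    using inj that gh by (metis injD)
  have "\<exists>s. \<bar>s\<bar> = 1 \<and> h v = s *\<^sub>R v" for v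
  proof (rule identity_up_to_sign[OF _ _ _ e])
    fix v w :: 'a and t :: real
    obtain s s' where "\<bar>s\<bar> = 1" "\<bar>s'\<bar> = 1" "f (v + w) = s *\<^sub>R f v + s' *\<^sub>R f w" using add by blast
    moreover from this have "h (v + w) = s *\<^sub>R h v + s' *\<^sub>R h w"
      by (intro eqI) (simp add: linear_add[OF lin] linear_scale[OF lin] gh)
    ultimately show "\<exists>s t. \<bar>s\<bar> = 1 \<and> \<bar>t\<bar> = 1 \<and> h (v + w) = s *\<^sub>R h v + t *\<^sub>R h w" by blast
    obtain s where "\<bar>s\<bar> = 1" "f (t *\<^sub>R v) = (s * t) *\<^sub>R f v" using scale by blast
    moreover from this have "h (t *\<^sub>R v) = (s * t) *\<^sub>R h v"
      by (intro eqI) (simp add: linear_scale[OF lin] gh)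
    ultimately show "\<exists>s. \<bar>s\<bar> = 1 \<and> h (t *\<^sub>R v) = (s * t) *\<^sub>R h v" by blast
  next
    fix b :: 'a assume b: "b \<in> Basis"
    obtain s where "\<bar>s\<bar> = 1" "f b = s *\<^sub>R p b" using pf by blast
    moreover from this have "h b = s *\<^sub>R b"
      by (intro eqI) (simp add: linear_scale[OF lin] gb[OF b])
    ultimately show "\<exists>s. \<bar>s\<bar> = 1 \<and> h b = s *\<^sub>R b" by blast
    assume "b \<noteq> e"
    then have "p b = r b *\<^sub>R f b" "p e = f e" by (simp_all add: p_def)
    then obtain s where "\<bar>s\<bar> = 1" "f (e + b) = s *\<^sub>R (p e + p b)" using r(2)[of b] by auto
    moreover from this have "h (e + b) = s *\<^sub>R (e + b)"
      by (intro eqI) (simp add: linear_scale[OF lin] linear_add[OF lin] gb[OF b] gb[OF e])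
    ultimately show "\<exists>s. \<bar>s\<bar> = 1 \<and> h (e + b) = s *\<^sub>R (e + b)" by blast
  qed
  then have sgn: "\<exists>s. \<bar>s\<bar> = 1 \<and> f v = s *\<^sub>R g v" for v
    using gh lin by (metis linear_scale)
  have seg: "\<Phi> (S v) = closed_segment (- g v) (g v)" for v
  proof -
    obtain s where "\<bar>s\<bar> = 1" "f v = s *\<^sub>R g v" using sgn by blast
    then have "f v = g v \<or> f v = - g v" by (auto simp: abs_if split: if_splits)
    then show ?thesis using f(1)[of v] by (auto simp: closed_segment_commute)
  qed
  show ?thesis using that[OF lin inj seg] .
qed

section \<open>Comparison with the difference body\<close>

text \<open>For \<open>lower\<close>, \<open>g (x - y)\<close> is an endpoint of the image of the
  segment from \<open>y\<close> to \<open>x\<close>. For \<open>upper\<close>, a point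
  \<open>z\<close> outside the difference body has, in some direction \<open>u\<close>, a larger
  component than the width of \<open>K\<close>, while the prism \<open>P\<close> bounds that
  component by the width.\<close>

lemma eq_linear_image_difference_body:
  obtains g where "linear g" "inj g" "\<And>K. K \<in> convex_bodies \<Longrightarrow> \<Phi> K = g ` difference_body K"
proof -
  obtain g where g: "linear g" "inj g" "\<And>v. \<Phi> (S v) = closed_segment (- g v) (g v)"
    using map_segment_linear by blast
  have seg: "\<Phi> (closed_segment a b) = closed_segment (- g (b - a)) (g (b - a))" for a b
  proof -
    have "(\<lambda>x. x + a) ` S (b - a) = closed_segment a b"
      using closed_segment_translation[of a 0 "b - a"] by (simp add: add.commute)
    then show ?thesis
      using translate[of "S (b - a)" a] g(3) by (simp add: convex_bodies_segment)
  qed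
  have segE: "\<exists>s. \<bar>s\<bar> \<le> 1 \<and> x = g (s *\<^sub>R (b - a))" if "x \<in> \<Phi> (closed_segment a b)" for x a b
    using that mem_centered_segment_iff[of x 0 "g (b - a)"]
    by (simp add: seg linear_scale[OF g(1)])
  have lower: "g ` difference_body K \<subseteq> \<Phi> K" if K: "K \<in> convex_bodies" for K
  proof
    fix z assume "z \<in> g ` difference_body K"
    then obtain x y where xy: "x \<in> K" "y \<in> K" "z = g (x - y)" by (auto simp: difference_body_alt)
    then have "closed_segment y x \<subseteq> K"
      using K by (simp add: convex_bodies_def closed_segment_subset)
    then have "\<Phi> (closed_segment y x) \<subseteq> \<Phi> K" using K mono convex_bodies_segment by blast
    then show "z \<in> \<Phi> K" using xy seg[of y x] by auto
  qed
  have upper: "\<Phi> K \<subseteq> g ` difference_body K" if K: "K \<in> convex_bodies" for K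
  proof
    fix y assume y: "y \<in> \<Phi> K"
    obtain z where z: "y = g z"
      using linear_injective_imp_surjective[OF g(1,2)] by blast
    have "z \<in> difference_body K"
    proof (rule ccontr)
      assume "z \<notin> difference_body K"
      then obtain a c where ac: "a \<bullet> z < c" "\<And>x. x \<in> difference_body K \<Longrightarrow> a \<bullet> x > c"
        using separating_hyperplane_closed_point[of "difference_body K" z]
          convex_bodies_difference_body[OF K] by (auto simp: convex_bodies_def compact_imp_closed)
      \<comment> \<open>The separation puts the difference body on the upper side of
        \<open>a\<close>. After the change of sign, \<open>u\<close> is bounded on it by the width
        of \<open>K\<close>, attained between \<open>x0\<close> and \<open>x1\<close>.\<close>
      define u where "u = - a"
      have cK: "compact K" "K \<noteq> {}" using K by (auto simp: convex_bodies_def)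
      have cont: "continuous_on K (\<lambda>x. u \<bullet> x)" by (intro continuous_intros)
      obtain x1 where x1: "x1 \<in> K" "\<And>x. x \<in> K \<Longrightarrow> u \<bullet> x \<le> u \<bullet> x1"
        using continuous_attains_sup[OF cK cont] by blast
      obtain x0 where x0: "x0 \<in> K" "\<And>x. x \<in> K \<Longrightarrow> u \<bullet> x0 \<le> u \<bullet> x"
        using continuous_attains_inf[OF cK cont] by blast
      have "x1 - x0 \<in> difference_body K" using x0 x1 by (auto simp: difference_body_alt)
      then have less: "u \<bullet> (x1 - x0) < u \<bullet> z" using ac by (force simp: u_def)
      then have "u \<noteq> 0" by auto
      then have uu: "u \<bullet> u > 0" by simp
      obtain R where R: "\<And>x. x \<in> K \<Longrightarrow> norm x \<le> R"
        using compact_imp_bounded[OF cK(1)] by (auto simp: bounded_iff)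
      \<comment> \<open>\<open>q\<close> projects onto the orthogonal complement of \<open>u\<close>. The projected basis vectors are linearly
        dependent, but \<open>P\<close> only has to contain a translate of \<open>K\<close> and to have the width of \<open>K\<close> in direction \<open>u\<close>.\<close>
      define w where "w = u \<bullet> (x1 - x0) / (u \<bullet> u)"
      define q where "q = (\<lambda>b::'a. b - ((u \<bullet> b) / (u \<bullet> u)) *\<^sub>R u)"
      have uq: "u \<bullet> q b = 0" for b using uu by (simp add: q_def inner_diff_right)
      define T where "T = (\<lambda>b. closed_segment (- (2 * R) *\<^sub>R q b) ((2 * R) *\<^sub>R q b))"
      define P where "P = S (w *\<^sub>R u) + (\<Sum>b\<in>Basis. T b)"
      have T: "T b \<in> convex_bodies" for b by (simp add: T_def convex_bodies_segment)
      then have P: "P \<in> convex_bodies"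
        unfolding P_def by (intro convex_bodies_plus convex_bodies_sum convex_bodies_segment)
      have "K \<subseteq> (\<lambda>x. x + x0) ` P"
      proof
        fix x assume x: "x \<in> K"
        define t where "t = u \<bullet> (x - x0) / (u \<bullet> u)"
        have t: "0 \<le> t" "t \<le> w"
          using x0(2)[OF x] x1(2)[OF x] uu
          by (auto simp: t_def w_def inner_diff_right intro!: divide_right_mono)
        have "t *\<^sub>R u \<in> S (w *\<^sub>R u)"
          using t by (cases "w = 0") (auto simp: in_segment intro!: exI[of _ "t / w"])
        moreover have "((x - x0) \<bullet> b) *\<^sub>R q b \<in> T b" if b: "b \<in> Basis" for b
        proof -
          have "\<bar>(x - x0) \<bullet> b\<bar> \<le> norm (x - x0)" using b by (rule Basis_le_norm)
          also have "\<dots> \<le> 2 * R" using R[OF x] R[OF x0(1)] norm_triangle_ineq4[of x x0] by linarith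
          finally have le: "\<bar>(x - x0) \<bullet> b\<bar> \<le> 2 * R" .
          have "T b = closed_segment (0 - (2 * R) *\<^sub>R q b) (0 + (2 * R) *\<^sub>R q b)" by (simp add: T_def)
          \<comment> \<open>For \<open>R = 0\<close> the quotient is 0 by convention, and
            \<open>le\<close> makes the coordinate vanish as well, so the factorisation below stays
            correct.\<close>
          moreover have "\<bar>((x - x0) \<bullet> b) / (2 * R)\<bar> \<le> 1"
            using le by (cases "R = 0") (auto simp: abs_divide divide_le_eq_1)
          moreover have "(x - x0) \<bullet> b = ((x - x0) \<bullet> b) / (2 * R) * (2 * R)" using le by auto
          ultimately show ?thesis
            unfolding mem_centered_segment_iff
            by (metis (no_types, opaque_lifting) add_0 mem_centered_segment_iff scaleR_scaleR)
        qed
        then have "(\<Sum>b\<in>Basis. ((x - x0) \<bullet> b) *\<^sub>R q b) \<in> (\<Sum>b\<in>Basis. T b)"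
          by (intro mem_sum_sets) auto
        ultimately have "t *\<^sub>R u + (\<Sum>b\<in>Basis. ((x - x0) \<bullet> b) *\<^sub>R q b) \<in> P"
          unfolding P_def by (intro set_plus_intro)
        moreover have "t *\<^sub>R u + (\<Sum>b\<in>Basis. ((x - x0) \<bullet> b) *\<^sub>R q b) = x - x0"
        proof -
          have "(\<Sum>b\<in>Basis. ((x - x0) \<bullet> b) *\<^sub>R q b)
              = (\<Sum>b\<in>Basis. ((x - x0) \<bullet> b) *\<^sub>R b)
                - ((\<Sum>b\<in>Basis. ((x - x0) \<bullet> b) * (u \<bullet> b)) / (u \<bullet> u)) *\<^sub>R u"
            by (simp add: q_def scaleR_diff_right sum_subtractf scaleR_sum_left sum_divide_distrib)
          also have "\<dots> = (x - x0) - t *\<^sub>R u"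
            by (simp add: euclidean_representation t_def euclidean_inner[of u "x - x0"] mult.commute)
          finally show ?thesis by simp
        qed
        ultimately have "x - x0 \<in> P" by simp
        then show "x \<in> (\<lambda>x. x + x0) ` P" by (intro image_eqI[of _ _ "x - x0"]) auto
      qed
      then have "\<Phi> K \<subseteq> \<Phi> P"
        using mono[OF K convex_bodies_translate[OF P]] translate[OF P] by simp
      also have "\<Phi> P = \<Phi> (S (w *\<^sub>R u)) + (\<Sum>b\<in>Basis. \<Phi> (T b))"
        unfolding P_def by (simp add: add map_sum T convex_bodies_sum convex_bodies_segment)
      finally obtain y1 y2 where y12: "g z = y1 + y2" "y1 \<in> \<Phi> (S (w *\<^sub>R u))" "y2 \<in> (\<Sum>b\<in>Basis. \<Phi> (T b))"
        using y z by (blast elim: set_plus_elim)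
      obtain s where s: "\<bar>s\<bar> \<le> 1" "y1 = g (s *\<^sub>R (w *\<^sub>R u - 0))" using segE[OF y12(2)] by blast
      obtain k where k: "y2 = (\<Sum>b\<in>Basis. k b)" "\<And>b. b \<in> Basis \<Longrightarrow> k b \<in> \<Phi> (T b)"
        using y12(3) by (auto simp: set_sum_alt)
      \<comment> \<open>The preimages of points of \<open>\<Phi> (T b)\<close> are orthogonal to
        \<open>u\<close>, so only the segment along \<open>u\<close> contributes to
        \<open>u \<bullet> z\<close>.\<close>
      have "\<exists>l. k b = g l \<and> u \<bullet> l = 0" if b: "b \<in> Basis" for b
      proof -
        obtain s where "k b = g (s *\<^sub>R ((2 * R) *\<^sub>R q b - - (2 * R) *\<^sub>R q b))"
          using segE[OF k(2)[OF b, unfolded T_def]] by blast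
        moreover have "u \<bullet> (s *\<^sub>R ((2 * R) *\<^sub>R q b - - (2 * R) *\<^sub>R q b)) = 0"
          by (simp add: uq inner_add_right)
        ultimately show ?thesis by blast
      qed
      then obtain l where l: "\<And>b. b \<in> Basis \<Longrightarrow> k b = g (l b)" "\<And>b. b \<in> Basis \<Longrightarrow> u \<bullet> l b = 0"
        by metis
      have "y2 = g (\<Sum>b\<in>Basis. l b)" using k l by (simp add: linear_sum[OF g(1)])
      then have "g z = g (s *\<^sub>R w *\<^sub>R u + (\<Sum>b\<in>Basis. l b))"
        using y12(1) s(2) by (simp add: linear_add[OF g(1)])
      then have "z = s *\<^sub>R w *\<^sub>R u + (\<Sum>b\<in>Basis. l b)" using g(2) by (metis injD)
      then have "u \<bullet> z = s * (u \<bullet> (x1 - x0))"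
        using l(2) uu by (simp add: inner_add_right inner_sum_right w_def)
      also have "\<dots> \<le> 1 * (u \<bullet> (x1 - x0))"
        using s x0(2)[OF x1(1)] by (intro mult_right_mono) (auto simp: inner_diff_right)
      finally show False using less by simp
    qed
    then show "y \<in> g ` difference_body K" using z by blast
  qed
  show ?thesis
    by (rule that[OF g(1,2)]) (use lower upper in blast)
qed

end

section \<open>Volume estimates\<close>

lemma measure_le_difference_body:
  fixes K :: "'a::euclidean_space set"
  assumes "K \<in> convex_bodies"
  shows "measure lebesgue K \<le> measure lebesgue (difference_body K)"
proof -
  obtain x0 where x0: "x0 \<in> K" using assms by (auto simp: convex_bodies_def)
  have "measure lebesgue K = measure lebesgue ((\<lambda>x. x - x0) ` K)"
    by (simp add: measure_translation_subtract)
  also have "\<dots> \<le> measure lebesgue (difference_body K)"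
  proof (rule measure_mono_fmeasurable)
    show "(\<lambda>x. x - x0) ` K \<subseteq> difference_body K" using x0 by (auto simp: difference_body_alt)
    have "compact ((\<lambda>x. x - x0) ` K)"
      using assms by (auto simp: convex_bodies_def intro!: compact_continuous_image continuous_on_diff)
    then show "(\<lambda>x. x - x0) ` K \<in> sets lebesgue"
      by (simp add: fmeasurableD lmeasurable_compact)
    show "difference_body K \<in> lmeasurable"
      using convex_bodies_difference_body[OF assms] by (simp add: convex_bodies_def lmeasurable_compact)
  qed
  finally show ?thesis .
qed

text \<open>Provides a matrix of maximal determinant, that is, a largest parallelepiped with edge
  vectors in \<open>K\<close>.\<close>

lemma compact_rows_mem:
  fixes K :: "(real ^ 'n) set"
  assumes "compact K"
  shows "compact {M :: real ^ 'n ^ 'm. \<forall>i. M $ i \<in> K}"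
proof -
  have "closed {M :: real ^ 'n ^ 'm. \<forall>i. M $ i \<in> K}"
    using assms
    by (intro closed_Collect_all continuous_closed_vimage[of K "\<lambda>M. M $ _", unfolded vimage_def])
       (auto intro: compact_imp_closed continuous_intros)
  moreover have "bounded {M :: real ^ 'n ^ 'm. \<forall>i. M $ i \<in> K}"
  proof -
    obtain R where R: "\<And>x. x \<in> K \<Longrightarrow> norm x \<le> R"
      using compact_imp_bounded[OF assms] by (auto simp: bounded_iff)
    have "norm M \<le> (\<Sum>i\<in>(UNIV::'m set). R)" if "\<forall>i. M $ i \<in> K" for M :: "real ^ 'n ^ 'm"
    proof -
      have "norm M \<le> (\<Sum>i\<in>UNIV. norm (M $ i))"
        unfolding norm_vec_def by (rule L2_set_le_sum) simp
      also have "\<dots> \<le> (\<Sum>i\<in>(UNIV::'m set). R)" using R that by (intro sum_mono) auto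
      finally show ?thesis .
    qed
    then show ?thesis by (auto simp: bounded_iff)
  qed
  ultimately show ?thesis by (simp add: compact_eq_bounded_closed)
qed

lemma continuous_on_det: "continuous_on A (det :: real ^ 'n ^ 'n \<Rightarrow> real)"
  unfolding det_def[abs_def] by (intro continuous_intros)

text \<open>If the maximal determinant is 0, then \<open>K\<close> lies in a proper subspace and
  \<open>D\<close> is null. Otherwise the rows of \<open>M\<close> serve as a basis, and
  \<open>0 \<in> K\<close> allows them to be shrunk within \<open>K\<close>.\<close>

lemma measure_differences_le_if_zero_mem:
  fixes K :: "(real ^ 'n) set"
  assumes K: "compact K" "convex K" and 0: "0 \<in> K"
  defines "D \<equiv> {x - y |x y. x \<in> K \<and> y \<in> K}"
  assumes D: "compact D"
  shows "measure lebesgue D \<le> (4 * real CARD('n)) ^ CARD('n) * measure lebesgue K"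
proof -
  let ?n = "real CARD('n)"
  have n: "?n > 0" by simp
  define A where "A = {M :: real ^ 'n ^ 'n. \<forall>i. M $ i \<in> K}"
  have A: "compact A" "A \<noteq> {}"
    unfolding A_def using compact_rows_mem K 0 by (auto intro!: exI[of _ 0])
  obtain M where M: "M \<in> A" "\<And>N. N \<in> A \<Longrightarrow> \<bar>det N\<bar> \<le> \<bar>det M\<bar>"
    using continuous_attains_sup[OF A, of "\<lambda>M. \<bar>det M\<bar>"] continuous_on_det
    by (auto intro: continuous_on_rabs)
  show ?thesis
  proof (cases "det M = 0")
    case True
    have "span K \<noteq> UNIV"
    proof
      assume sp: "span K = UNIV"
      \<comment> \<open>A basis contained in \<open>K\<close> supplies the rows of a matrix in
        \<open>A\<close> with nonzero determinant, against the maximum being 0.\<close>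
      obtain B where B: "B \<subseteq> K" "independent B" "K \<subseteq> span B"
        using maximal_independent_subset by blast
      then have spB: "span B = UNIV" using sp span_mono[OF B(3)] by (simp add: span_span top.extremum_unique)
      then have "card B = CARD('n)" "finite B"
        using dim_span_eq_card_independent[OF B(2)] independent_imp_finite[OF B(2)] by simp_all
      then obtain h where h: "bij_betw h (UNIV :: 'n set) B"
        using finite_same_card_bij[of "UNIV :: 'n set" B] by auto
      define N :: "real ^ 'n ^ 'n" where "N = (\<chi> i. h i)"
      have "N \<in> A" using h B(1) by (auto simp: A_def N_def bij_betw_def)
      then have "det N = 0" using M(2)[of N] True by simp
      moreover have "rows N = B"
        using h by (auto simp: rows_def row_def N_def bij_betw_def vec_nth_inverse image_iff)
      then have "det N \<noteq> 0"
        using spB matrix_left_invertible_span_rows[of N] invertible_left_inverse[of N] invertible_det_nz[of N]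
        by simp
      ultimately show False by simp
    qed
    moreover have "D \<subseteq> span K" by (auto simp: D_def intro: span_diff span_base)
    ultimately have "span D \<noteq> UNIV" by (metis span_minimal subspace_span top.extremum_unique)
    then have "dim D < DIM(real ^ 'n)" using dim_eq_full[of D] dim_subset_UNIV[of D] by linarith
    then have "measure lebesgue D = 0" using negligible_lowdim negligible_imp_measure0 by blast
    then show ?thesis by simp
  next
    case False
    have row: "row i M \<in> K" for i using M(1) by (auto simp: A_def row_def vec_lambda_eta)
    have "transpose M *v a = (\<Sum>i\<in>UNIV. a $ i *s row i M)" for a
      by (simp only: matrix_mult_sum column_transpose)
    moreover have "surj ((*v) (transpose M))"
      using False invertible_det_nz[of "transpose M"] matrix_right_invertible_surjective[of "transpose M"]
      by (auto simp: det_transpose invertible_right_inverse)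
    ultimately have surj: "\<exists>a. x = (\<Sum>i\<in>UNIV. a $ i *s row i M)" for x by (metis surjD)
    have sub: "\<exists>a. x = (\<Sum>i\<in>UNIV. a $ i *s row i M) \<and> (\<forall>k. \<bar>a $ k\<bar> \<le> 1)" if x: "x \<in> K" for x
    proof -
      obtain a where a: "x = (\<Sum>i\<in>UNIV. a $ i *s row i M)" using surj by blast
      have "\<bar>a $ k\<bar> \<le> 1" for k
      proof -
        \<comment> \<open>By Cramer's rule, putting \<open>x\<close> in row \<open>k\<close>
          multiplies the determinant by \<open>a $ k\<close>; maximality of \<open>M\<close> bounds
          this factor.\<close>
        have "((\<chi> i. if i = k then x else row i M) :: real ^ 'n ^ 'n) \<in> A"
          using row x by (auto simp: A_def)
        then have "\<bar>a $ k * det M\<bar> \<le> \<bar>det M\<bar>"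
          unfolding cramer_lemma_transpose[of k a M, symmetric] a using M(2) by blast
        then show ?thesis using False by (simp add: abs_mult)
      qed
      with a show ?thesis by blast
    qed
    \<comment> \<open>The coordinates of \<open>x - y\<close> lie in [-2, 2]; adding 2 and dividing
      by 4 brings them into [0, 1]. The vector \<open>p\<close> reverts the shift, and the factor
      \<open>4 * ?n\<close> reverts the division and the averaging over the rows.\<close>
    define p where "p = - 2 *\<^sub>R (\<Sum>i\<in>UNIV. row i M)"
    have "D \<subseteq> (\<lambda>x. (4 * ?n) *\<^sub>R x + p) ` K"
    proof
      fix z assume "z \<in> D"
      then obtain x y where xy: "x \<in> K" "y \<in> K" "z = x - y" by (auto simp: D_def)
      obtain a where a: "x = (\<Sum>i\<in>UNIV. a $ i *s row i M)" "\<And>k. \<bar>a $ k\<bar> \<le> 1"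
        using sub[OF xy(1)] by blast
      obtain b where b: "y = (\<Sum>i\<in>UNIV. b $ i *s row i M)" "\<And>k. \<bar>b $ k\<bar> \<le> 1"
        using sub[OF xy(2)] by blast
      define t where "t = (\<lambda>i. (a $ i - b $ i + 2) / 4)"
      have t: "0 \<le> t i" "t i \<le> 1" for i using a(2)[of i] b(2)[of i] by (simp_all add: t_def)
      have in_K: "t i *\<^sub>R row i M \<in> K" for i
        using convexD[OF K(2) row 0, of "t i" "1 - t i"] t by simp
      have "(\<Sum>i\<in>UNIV. (1 / ?n) *\<^sub>R (t i *\<^sub>R row i M)) \<in> K"
        using in_K K(2) by (intro convex_sum) auto
      moreover have "z = (4 * ?n) *\<^sub>R (\<Sum>i\<in>UNIV. (1 / ?n) *\<^sub>R (t i *\<^sub>R row i M)) + p"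
      proof -
        have "z = (\<Sum>i\<in>UNIV. (a $ i - b $ i) *\<^sub>R row i M)"
          unfolding xy(3) a(1) b(1) by (simp add: scalar_mult_eq_scaleR scaleR_diff_left sum_subtractf)
        also have "\<dots> = (\<Sum>i\<in>UNIV. (- 2) *\<^sub>R row i M + (4 * t i) *\<^sub>R row i M)"
        proof (intro sum.cong refl)
          fix i
          have "a $ i - b $ i = - 2 + 4 * t i" by (simp add: t_def field_simps)
          then show "(a $ i - b $ i) *\<^sub>R row i M = (- 2) *\<^sub>R row i M + (4 * t i) *\<^sub>R row i M"
            by (simp only: scaleR_add_left)
        qed
        also have "\<dots> = (4 * ?n) *\<^sub>R (\<Sum>i\<in>UNIV. (1 / ?n) *\<^sub>R (t i *\<^sub>R row i M)) + p"
          using n by (simp add: p_def sum_subtractf sum_negf scaleR_sum_right)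
        finally show ?thesis .
      qed
      ultimately show "z \<in> (\<lambda>x. (4 * ?n) *\<^sub>R x + p) ` K" by blast
    qed
    moreover have "compact ((\<lambda>x. (4 * ?n) *\<^sub>R x + p) ` K)"
      using K(1) by (intro compact_continuous_image continuous_intros)
    ultimately have "measure lebesgue D \<le> measure lebesgue ((\<lambda>x. (4 * ?n) *\<^sub>R x + p) ` K)"
      using D by (intro measure_mono_fmeasurable) (simp_all add: fmeasurableD lmeasurable_compact)
    then show ?thesis by (simp add: measure_lebesgue_affine)
  qed
qed

text \<open>The difference body is unchanged by translations of \<open>K\<close>, so 0 may be moved
  into \<open>K\<close>.\<close>

lemma measure_difference_body_le:
  fixes K :: "(real ^ 'n) set"
  assumes K: "K \<in> convex_bodies"
  shows "measure lebesgue (difference_body K) \<le> (4 * real CARD('n)) ^ CARD('n) * measure lebesgue K"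
proof -
  obtain x0 where x0: "x0 \<in> K" using K by (auto simp: convex_bodies_def)
  let ?K = "(\<lambda>x. x - x0) ` K"
  have cK: "compact ?K"
    using K by (auto simp: convex_bodies_def intro!: compact_continuous_image continuous_on_diff)
  have "convex ?K"
    using K convex_translation_subtract[of K x0] by (simp add: convex_bodies_def)
  have D: "difference_body K = {x - y |x y. x \<in> ?K \<and> y \<in> ?K}"
    unfolding difference_body_alt
  proof safe
    fix x y assume "x \<in> K" "y \<in> K"
    then show "\<exists>u v. x - y = u - v \<and> u \<in> ?K \<and> v \<in> ?K"
      by (intro exI[of _ "x - x0"] exI[of _ "y - x0"]) simp
  next
    fix x y assume "x \<in> K" "y \<in> K"
    then show "\<exists>u v. (x - x0) - (y - x0) = u - v \<and> u \<in> K \<and> v \<in> K"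
      by (intro exI[of _ x] exI[of _ y]) simp
  qed
  have "compact (difference_body K)"
    using convex_bodies_difference_body[OF K] by (simp add: convex_bodies_def)
  then show ?thesis
    using measure_differences_le_if_zero_mem[OF cK \<open>convex ?K\<close>] x0 unfolding D
    by (auto simp: measure_translation_subtract)
qed


section \<open>Volume under invertible linear maps\<close>

text \<open>The change of variables formula of the library requires a well-ordered index type. Here
  \<open>S\<close> is exhausted by disjoint balls, for which the inequality follows by scaling.\<close>

lemma emeasure_injective_linear_image_ge:
  fixes g :: "'a::euclidean_space \<Rightarrow> 'a"
  assumes g: "linear g" "inj g" and S: "open S"
  shows "emeasure lebesgue (g ` ball 0 1) * emeasure lebesgue S
    \<le> emeasure lebesgue (ball 0 1 :: 'a set) * emeasure lebesgue (g ` S)"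
proof -
  have opn: "open (g ` U)" if "open U" for U
    using open_surjective_linear_image[OF that g(1)] linear_injective_imp_surjective[OF g] by blast
  have sets: "g ` U \<in> sets lebesgue" "U \<in> sets lebesgue" if "open U" for U
    using opn that by (auto simp: sets_completionI_sets)
  \<comment> \<open>A ball is a scaled translate of the unit ball, and by linearity its image is the
    corresponding copy of the image of the unit ball. Both volumes thus scale by the same power of
    \<open>r\<close>.\<close>
  have ball: "ball x r = (\<lambda>y. r *\<^sub>R y + x) ` ball 0 1" if "r > 0" for x :: 'a and r
  proof -
    have "(+) x ` (*\<^sub>R) r ` ball 0 1 = ball x r" using that by (simp add: ball_scale)
    then show ?thesis by (simp only: image_image add.commute[of x])
  qed
  have eball: "emeasure lebesgue (ball x r) = ennreal (r ^ DIM('a)) * emeasure lebesgue (ball 0 1 :: 'a set)"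
    if "r > 0" for x :: 'a and r
    unfolding ball[OF that] using that by (simp add: emeasure_lebesgue_affine)
  have egball: "emeasure lebesgue (g ` ball x r) = ennreal (r ^ DIM('a)) * emeasure lebesgue (g ` ball 0 1)"
    if "r > 0" for x :: 'a and r
  proof -
    have "g ` ball x r = (\<lambda>y. r *\<^sub>R y + g x) ` (g ` ball 0 1)"
      unfolding ball[OF that] by (simp add: image_image linear_add[OF g(1)] linear_scale[OF g(1)])
    then show ?thesis using that by (simp add: emeasure_lebesgue_affine)
  qed
  \<comment> \<open>The covering theorem asks for balls of arbitrarily small radius around each
    point of \<open>S\<close>; the bound \<open>d / 2\<close> used below keeps the radius strictly
    below \<open>d\<close>.\<close>
  define I where "I = {(x, r). 0 < r \<and> ball x r \<subseteq> S}"
  have "\<exists>i. i \<in> I \<and> x \<in> ball (fst i) (snd i) \<and> snd i < d" if x: "x \<in> S" and d: "0 < d" for x d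
  proof -
    obtain e where e: "0 < e" "ball x e \<subseteq> S" using openE[OF S x] by metis
    have "ball x (min e (d / 2)) \<subseteq> ball x e" by (simp add: subset_ball)
    then show ?thesis
      using e d by (intro exI[of _ "(x, min e (d / 2))"]) (auto simp: I_def)
  qed
  then obtain C where C: "countable C" "C \<subseteq> I"
      "pairwise (\<lambda>i j. disjnt (ball (fst i) (snd i)) (ball (fst j) (snd j))) C"
      "negligible (S - (\<Union>i\<in>C. ball (fst i) (snd i)))"
    by (rule Vitali_covering_theorem_balls[of S I fst snd]) blast
  let ?B = "\<lambda>i. ball (fst i) (snd i)"
  have pos: "0 < snd i" "?B i \<subseteq> S" if "i \<in> C" for i
    using subsetD[OF C(2) that] by (simp_all add: I_def split_beta)
  have disj: "disjoint_family_on ?B C"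
    using C(3) by (auto simp: disjoint_family_on_def pairwise_def disjnt_def)
  then have gdisj: "disjoint_family_on (\<lambda>i. g ` ?B i) C"
    using g(2) by (simp add: disjoint_family_on_def image_Int[symmetric])
  have "S = (\<Union>i\<in>C. ?B i) \<union> (S - (\<Union>i\<in>C. ?B i))" using pos by blast
  then have "emeasure lebesgue S = emeasure lebesgue (\<Union>i\<in>C. ?B i)"
    using emeasure_Un_null_set[of "\<Union>i\<in>C. ?B i" lebesgue "S - (\<Union>i\<in>C. ?B i)"] C(4) sets(2)
    by (simp add: negligible_iff_null_sets open_UN)
  also have "\<dots> = (\<integral>\<^sup>+i. emeasure lebesgue (?B i) \<partial>count_space C)"
    by (intro emeasure_UN_countable disj C(1)) (simp add: sets)
  also have "\<dots> = (\<integral>\<^sup>+i. ennreal (snd i ^ DIM('a)) * emeasure lebesgue (ball 0 1 :: 'a set) \<partial>count_space C)"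
    by (intro nn_integral_cong eball pos(1)) simp
  also have "\<dots> = (\<integral>\<^sup>+i. ennreal (snd i ^ DIM('a)) \<partial>count_space C) * emeasure lebesgue (ball 0 1 :: 'a set)"
    by (intro nn_integral_multc) simp
  finally have eS: "emeasure lebesgue S
    = (\<integral>\<^sup>+i. ennreal (snd i ^ DIM('a)) \<partial>count_space C) * emeasure lebesgue (ball 0 1 :: 'a set)" .
  have "(\<integral>\<^sup>+i. ennreal (snd i ^ DIM('a)) \<partial>count_space C) * emeasure lebesgue (g ` ball 0 1)
    = (\<integral>\<^sup>+i. ennreal (snd i ^ DIM('a)) * emeasure lebesgue (g ` ball 0 1) \<partial>count_space C)"
    by (intro nn_integral_multc[symmetric]) simp
  also have "\<dots> = (\<integral>\<^sup>+i. emeasure lebesgue (g ` ?B i) \<partial>count_space C)"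
    by (intro nn_integral_cong egball[symmetric] pos(1)) simp
  also have "\<dots> = emeasure lebesgue (\<Union>i\<in>C. g ` ?B i)"
    by (intro emeasure_UN_countable[symmetric] gdisj C(1)) (simp add: sets)
  \<comment> \<open>The part of \<open>S\<close> missed by the balls is null, but its image is
    merely discarded here, whence an inequality.\<close>
  also have "\<dots> \<le> emeasure lebesgue (g ` S)"
    using pos(2) by (intro emeasure_mono UN_least image_mono) (auto simp: sets S)
  finally have le: "(\<integral>\<^sup>+i. ennreal (snd i ^ DIM('a)) \<partial>count_space C) * emeasure lebesgue (g ` ball 0 1)
    \<le> emeasure lebesgue (g ` S)" .
  have swap: "a * (b * c) = c * (b * a)" for a b c :: ennreal by (simp only: ac_simps)
  show ?thesis unfolding eS swap[of "emeasure lebesgue (g ` ball 0 1)"] by (rule mult_left_mono[OF le]) simp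
qed

text \<open>The constant is the ratio of the volumes of \<open>g\<close> and of the unit ball under
  it and before it, respectively. Passing to the interior loses no volume, since the frontier of a
  convex set is null.\<close>

lemma measure_injective_linear_image_ge:
  fixes g :: "'a::euclidean_space \<Rightarrow> 'a"
  assumes g: "linear g" "inj g"
  obtains c where "0 < c"
    "\<And>K. K \<in> convex_bodies \<Longrightarrow> c * measure lebesgue K \<le> measure lebesgue (g ` K)"
proof -
  let ?B = "ball 0 1 :: 'a set"
  have opn: "open (g ` U)" if "open U" for U
    using open_surjective_linear_image[OF that g(1)] linear_injective_imp_surjective[OF g] by blast
  have lm: "U \<in> lmeasurable" if "open U" "bounded U" for U :: "'a set"
    using that by (simp add: lmeasurable_open)
  have bdd: "bounded (g ` U)" if "bounded U" for U
    using that g(1) by (simp add: bounded_linear_image linear_conv_bounded_linear)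
  have gB: "0 < measure lebesgue (g ` ?B)" and B: "0 < measure lebesgue ?B"
    using opn[of ?B] lm[of ?B] lm[of "g ` ?B"] bdd[of ?B] open_not_negligible[of ?B]
      open_not_negligible[of "g ` ?B"] negligible_iff_measure0[of ?B] negligible_iff_measure0[of "g ` ?B"]
      measure_nonneg[of lebesgue ?B] measure_nonneg[of lebesgue "g ` ?B"]
    by (auto simp: less_le)
  have "measure lebesgue (g ` ?B) / measure lebesgue ?B * measure lebesgue K \<le> measure lebesgue (g ` K)"
    if K: "K \<in> convex_bodies" for K
  proof -
    let ?S = "interior K"
    have cK: "compact K" "convex K" using K by (auto simp: convex_bodies_def)
    have S: "open ?S" "bounded ?S" using cK compact_imp_bounded bounded_interior by auto
    have "compact (g ` K)"
      using cK g(1) by (intro compact_continuous_image linear_continuous_on) (auto simp: linear_conv_bounded_linear)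
    then have "measure lebesgue (g ` ?S) \<le> measure lebesgue (g ` K)"
      using interior_subset opn[OF S(1)] bdd[OF S(2)] lm
      by (intro measure_mono_fmeasurable) (auto simp: fmeasurableD lmeasurable_compact)
    then have le: "measure lebesgue ?B * measure lebesgue (g ` ?S) \<le> measure lebesgue ?B * measure lebesgue (g ` K)"
      by (intro mult_left_mono) auto
    have eq: "measure lebesgue ?S = measure lebesgue K"
      using cK by (intro measure_interior) (auto simp: compact_imp_bounded negligible_convex_frontier)
    have "measure lebesgue (g ` ?B) * measure lebesgue ?S \<le> measure lebesgue ?B * measure lebesgue (g ` ?S)"
      using emeasure_injective_linear_image_ge[OF g S(1)] S opn bdd lm
      by (simp add: emeasure_eq_measure2 ennreal_mult[symmetric])
    from order.trans[OF this le, unfolded eq]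
    have "measure lebesgue (g ` ?B) * measure lebesgue K \<le> measure lebesgue ?B * measure lebesgue (g ` K)" .
    then show ?thesis using B by (simp add: field_simps)
  qed
  then show ?thesis using that[of "measure lebesgue (g ` ?B) / measure lebesgue ?B"] gB B by simp
qed

section \<open>The two implications, in matrix form\<close>

text \<open>The lower constant comes from \<open>g\<close>, the upper one from its inverse
  \<open>h\<close>: as \<open>h\<close> maps \<open>\<Phi> K\<close> back to the difference body,
  \<open>d\<close> times the volume of \<open>\<Phi> K\<close> is at most \<open>?N\<close> times
  that of \<open>K\<close>.\<close>

lemma mono_on_and_volume_constraint_linear_image:
  fixes g :: "real ^ 'n ^ 'n"
  assumes g: "invertible g" and \<Phi>: "\<And>K. K \<in> convex_bodies \<Longrightarrow> \<Phi> K = (*v) g ` difference_body K"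
  shows "mono_on convex_bodies \<Phi>" "volume_constraint \<Phi>"
proof -
  show "mono_on convex_bodies \<Phi>"
    by (intro mono_onI) (auto simp: \<Phi> difference_body_alt)
  obtain h where h: "g ** h = mat 1" "h ** g = mat 1" using g unfolding invertible_def by blast
  have hg: "h *v (g *v x) = x" and gh: "g *v (h *v x) = x" for x
    by (simp_all add: h matrix_vector_mul_assoc)
  have lin: "linear ((*v) g)" "inj ((*v) g)" "linear ((*v) h)" "inj ((*v) h)"
    using hg gh by (auto simp: matrix_vector_mul_linear) (metis injI)+
  obtain c where c: "0 < c"
      "\<And>K. K \<in> convex_bodies \<Longrightarrow> c * measure lebesgue K \<le> measure lebesgue ((*v) g ` K)"
    using measure_injective_linear_image_ge[OF lin(1,2)] by blast
  obtain d where d: "0 < d"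
      "\<And>K. K \<in> convex_bodies \<Longrightarrow> d * measure lebesgue K \<le> measure lebesgue ((*v) h ` K)"
    using measure_injective_linear_image_ge[OF lin(3,4)] by blast
  let ?N = "(4 * real CARD('n)) ^ CARD('n)"
  have lower: "c * measure lebesgue K \<le> measure lebesgue (\<Phi> K)" if K: "K \<in> convex_bodies" for K
    unfolding \<Phi>[OF K]
    using mult_left_mono[OF measure_le_difference_body[OF K] less_imp_le[OF c(1)]]
      c(2)[OF convex_bodies_difference_body[OF K]] by linarith
  have upper: "measure lebesgue (\<Phi> K) \<le> (?N / d) * measure lebesgue K" if K: "K \<in> convex_bodies" for K
  proof -
    have D: "difference_body K \<in> convex_bodies" using K by (rule convex_bodies_difference_body)
    have "\<Phi> K \<in> convex_bodies"
      unfolding \<Phi>[OF K] using D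
      by (auto simp: convex_bodies_def convex_linear_image lin(1)
          intro!: compact_continuous_image linear_continuous_on simp flip: linear_conv_bounded_linear)
    moreover have "(*v) h ` \<Phi> K = difference_body K" by (simp add: \<Phi>[OF K] image_image hg)
    ultimately have "d * measure lebesgue (\<Phi> K) \<le> ?N * measure lebesgue K"
      using d(2)[of "\<Phi> K"] measure_difference_body_le[OF K] by simp
    then show ?thesis using d(1) by (simp add: field_simps)
  qed
  have "0 < ?N / d" using d(1) by simp
  with c(1) lower upper show "volume_constraint \<Phi>" unfolding volume_constraint_def by blast
qed

theorem theorem1p3:
  fixes \<Phi> :: "(real ^ 'n) set \<Rightarrow> (real ^ 'n) set"
  assumes "CARD('n) \<ge> 2"
    and "\<Phi> \<in> convex_bodies \<rightarrow> convex_bodies"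
    and "minkowski_additive \<Phi>"
    and "continuous_map hausdorff_topology hausdorff_topology \<Phi>"
    and "translation_invariant \<Phi>"
  shows "mono_on convex_bodies \<Phi> \<and> volume_constraint \<Phi> \<longleftrightarrow>
    (\<exists>g :: real ^ 'n ^ 'n. invertible g \<and>
      (\<forall>K\<in>convex_bodies. \<Phi> K = (*v) g ` difference_body K))"
proof
  assume *: "mono_on convex_bodies \<Phi> \<and> volume_constraint \<Phi>"
  then obtain c C where cC: "0 < c" "0 < C"
      "\<And>K. K \<in> convex_bodies \<Longrightarrow> c * measure lebesgue K \<le> measure lebesgue (\<Phi> K) \<and>
        measure lebesgue (\<Phi> K) \<le> C * measure lebesgue K"
    unfolding volume_constraint_def by blast
  interpret monotone_endomorphism \<Phi>
  proof
    fix K L :: "(real ^ 'n) set" and t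
    assume K: "K \<in> convex_bodies"
    show "\<Phi> K \<in> convex_bodies" using K assms(2) by blast
    show "\<Phi> ((\<lambda>x. x + t) ` K) = \<Phi> K" using K assms(5) by (simp add: translation_invariant_def)
    \<comment> \<open>The lower bound of (VC) gives one implication, the upper bound the
      other.\<close>
    show "measure lebesgue (\<Phi> K) = 0 \<longleftrightarrow> measure lebesgue K = 0"
    proof
      assume "measure lebesgue (\<Phi> K) = 0"
      then have "c * measure lebesgue K \<le> 0" using cC(3)[OF K] by simp
      then show "measure lebesgue K = 0"
        using cC(1) measure_nonneg[of lebesgue K] by (simp add: mult_le_0_iff)
    next
      assume "measure lebesgue K = 0"
      then show "measure lebesgue (\<Phi> K) = 0"
        using cC(3)[OF K] measure_nonneg[of lebesgue "\<Phi> K"] by simp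
    qed
    assume L: "L \<in> convex_bodies"
    show "\<Phi> (K + L) = \<Phi> K + \<Phi> L" using K L assms(3) by (simp add: minkowski_additive_def)
    assume "K \<subseteq> L"
    then show "\<Phi> K \<subseteq> \<Phi> L" using K L * by (meson mono_onD)
  next
    show "DIM(real ^ 'n) \<ge> 2" using assms(1) by simp
  qed
  obtain g where g: "linear g" "inj g" "\<And>K. K \<in> convex_bodies \<Longrightarrow> \<Phi> K = g ` difference_body K"
    using eq_linear_image_difference_body by blast
  have "(*v) (matrix g) = g" using matrix_works[OF g(1)[folded linear_matrix_vector_mul_eq]] by auto
  moreover have "invertible (matrix g)"
    using det_nz_iff_inj[OF g(1)] g(2) invertible_det_nz by blast
  ultimately show "\<exists>g :: real ^ 'n ^ 'n. invertible g \<and>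
      (\<forall>K\<in>convex_bodies. \<Phi> K = (*v) g ` difference_body K)"
    using g(3) by (intro exI[of _ "matrix g"]) simp
next
  assume "\<exists>g :: real ^ 'n ^ 'n. invertible g \<and>
      (\<forall>K\<in>convex_bodies. \<Phi> K = (*v) g ` difference_body K)"
  then obtain g :: "real ^ 'n ^ 'n" where "invertible g"
      "\<And>K. K \<in> convex_bodies \<Longrightarrow> \<Phi> K = (*v) g ` difference_body K" by blast
  then show "mono_on convex_bodies \<Phi> \<and> volume_constraint \<Phi>"
    using mono_on_and_volume_constraint_linear_image[of g \<Phi>] by simp
qed

end
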